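(* Let $P_{\partial(\sigma_{d+1})}$ be the $d$-th Laplacian polytope of the boundary of the $(d+1)$-simplex. Then: (a) if $d\in\mathbb{N}$ is odd, the $h^\ast$-polynomial $h^\ast(P_{\partial(\sigma_{d+1})};t)$ has only real roots; (b) for every $d\in\mathbb{N}$, the $h^\ast$-vector $h^\ast(P_{\partial(\sigma_{d+1})})$ is unimodal with peak in the middle, i.e. with $D=\dim P_{\partial(\sigma_{d+1})}$ (which equals $d$ if $d$ is even and $d+1$ if $d$ is odd), $$h^\ast_0\le h^\ast_1\le\dots\le h^\ast_{D/2}\ge h^\ast_{D/2+1}\ge\dots\ge h^\ast_{D}.$$
   Context: Let $\sigma_{d+1}=2^{[d+2]}$ be the full simplex on vertex set $[d+2]=\{1<2<\dots<d+2\}$ and $\partial(\sigma_{d+1})=\sigma_{d+1}\setminus\{[d+2]\}$ its boundary, a $d$-dimensional simplicial complex. For a simplicial complex $\Delta$ on an ordered vertex set, $C_i(\Delta)$ is the $\mathbb{Q}$-vector space with basis $e_\sigma$, $\sigma$ an $i$-dimensional face, with $C_i(\Delta)=0$ for $i\le -1$ and $i>\dim\Delta$; the boundary map $\partial_i:C_i(\Delta)\to C_{i-1}(\Delta)$ is $\partial_i(e_\sigma)=\sum_{k=1}^{i+1}(-1)^{k-1}e_{\sigma\setminus\{j_k\}}$ for $\sigma=\{j_1<\dots<j_{i+1}\}$ (so $\partial_0=0$). The $i$-th Laplacian matrix is $\mathcal{L}_i(\Delta)=\partial_{i+1}\partial_{i+1}^{\top}+\partial_i^{\top}\partial_i$.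 For $\Delta=\partial(\sigma_{d+1})$ the rows and columns of $\mathcal{L}_d(\Delta)\in\mathbb{Z}^{(d+2)\times(d+2)}$ are ordered according to the facets $F_1,\dots,F_{d+2}$, where $F_i=[d+2]\setminus\{d+3-i\}$. Then $P_{\partial(\sigma_{d+1})}\subseteq\mathbb{R}^{d+2}$ is the convex hull of the columns of $\mathcal{L}_d(\partial(\sigma_{d+1}))$. For a lattice polytope $P\subseteq\mathbb{R}^m$ of dimension $D$, its $h^\ast$-polynomial $h^\ast(P;t)=\sum_{i=0}^{D}h^\ast_i t^i$ is defined by $\sum_{n\ge0}|nP\cap\mathbb{Z}^m|\,t^n=h^\ast(P;t)/(1-t)^{D+1}$, and $h^\ast(P)=(h_0^\ast,\dots,h_D^\ast)$ is its $h^\ast$-vector (with trailing zeros allowed). *)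

theory Defs
  imports
    "HOL-Analysis.Analysis"
    "HOL-Computational_Algebra.Computational_Algebra"
begin

section \<open>Laplacians of simplicial complexes\<close>

text \<open>
  The basis of \<open>C\<^sub>i(\<Delta>)\<close>. The empty face of \<open>\<Delta>\<close> is deliberately left out:
  the chain complex is not augmented, so \<open>C\<^sub>i(\<Delta>) = 0\<close> for all \<open>i \<le> -1\<close>.
\<close>

definition faces :: "'a set set \<Rightarrow> int \<Rightarrow> 'a set set" where
  "faces \<Delta> i = {\<sigma> \<in> \<Delta>. 0 \<le> i \<and> int (card \<sigma>) = i + 1}"

text \<open>
  The coefficient of \<open>e\<^sub>\<tau>\<close> in \<open>\<partial>(e\<^sub>\<sigma>) = \<Sum>\<^sub>k (-1)\<^sup>k\<^sup>-\<^sup>1 e\<^bsub>\<sigma> - {j\<^sub>k}\<^esub>\<close>, where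
  \<open>\<sigma> = {j\<^sub>1 < j\<^sub>2 < \<dots>}\<close>. Here \<open>k\<close> starts at \<open>0\<close>, hence the exponent \<open>k\<close>.
  This is the \<open>(\<tau>, \<sigma>)\<close> entry of the matrix of \<open>\<partial>\<^sub>i\<close> whenever
  \<open>\<sigma> \<in> faces \<Delta> i\<close> and \<open>\<tau> \<in> faces \<Delta> (i - 1)\<close>.
\<close>

definition boundary_entry :: "'a::linorder set \<Rightarrow> 'a set \<Rightarrow> int" where
  "boundary_entry \<tau> \<sigma> =
     (\<Sum>k<card \<sigma>. if \<tau> = \<sigma> - {sorted_list_of_set \<sigma> ! k} then (-1) ^ k else 0)"

text \<open>
  The \<open>(\<sigma>, \<sigma>')\<close> entry of \<open>\<partial>\<^bsub>i+1\<^esub> \<partial>\<^bsub>i+1\<^esub>\<^sup>T + \<partial>\<^sub>i\<^sup>T \<partial>\<^sub>i\<close>, with the two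
  matrix products written out, for \<open>\<sigma>\<close> and \<open>\<sigma>'\<close> in \<open>faces \<Delta> i\<close>.
\<close>

definition laplacian :: "'a::linorder set set \<Rightarrow> int \<Rightarrow> 'a set \<Rightarrow> 'a set \<Rightarrow> int" where
  "laplacian \<Delta> i \<sigma> \<sigma>' =
     (\<Sum>\<rho>\<in>faces \<Delta> (i + 1). boundary_entry \<sigma> \<rho> * boundary_entry \<sigma>' \<rho>) +
     (\<Sum>\<tau>\<in>faces \<Delta> (i - 1). boundary_entry \<tau> \<sigma> * boundary_entry \<tau> \<sigma>')"

section \<open>The Laplacian polytope of the boundary of a simplex\<close>

definition simplex_boundary :: "nat \<Rightarrow> nat set set" where
  "simplex_boundary d = Pow {1..d+2} - {{1..d+2}}"

definition simplex_facet :: "nat \<Rightarrow> nat \<Rightarrow> nat set" where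
  "simplex_facet d i = {1..d+2} - {d + 3 - i}"

text \<open>
  The space \<open>\<real>\<^sup>d\<^sup>+\<^sup>2\<close> is \<^typ>\<open>real ^ 'n\<close> together with a numbering \<open>ix\<close> of its
  coordinates, intended to be a bijection from \<^typ>\<open>'n\<close> onto \<open>{1..d+2}\<close>: the row and
  column with index \<open>r\<close> belong to the facet number \<open>ix r\<close>.
\<close>

definition laplacian_matrix :: "('n::finite \<Rightarrow> nat) \<Rightarrow> nat \<Rightarrow> real ^ 'n ^ 'n" where
  "laplacian_matrix ix d =
     (\<chi> r c. of_int (laplacian (simplex_boundary d) (int d)
                       (simplex_facet d (ix r)) (simplex_facet d (ix c))))"

definition laplacian_polytope :: "('n::finite \<Rightarrow> nat) \<Rightarrow> nat \<Rightarrow> (real ^ 'n) set" where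
  "laplacian_polytope ix d = convex hull (columns (laplacian_matrix ix d))"

section \<open>The \<open>h\<^sup>*\<close>-polynomial\<close>

definition lattice_points :: "(real ^ 'n) set \<Rightarrow> (real ^ 'n) set" where
  "lattice_points S = {x \<in> S. \<forall>i. x $ i \<in> \<int>}"

definition ehrhart_series :: "(real ^ 'n) set \<Rightarrow> real fps" where
  "ehrhart_series P =
     Abs_fps (\<lambda>n. of_nat (card (lattice_points ((\<lambda>x. real n *\<^sub>R x) ` P))))"

text \<open>
  For a nonempty lattice polytope, exactly one polynomial has the property below, by the
  theorems of Ehrhart and Stanley; for other sets the value is not meaningful.
\<close>

definition hstar_poly :: "(real ^ 'n::finite) set \<Rightarrow> real poly" where
  "hstar_poly P =
     (THE h. degree h \<le> nat (aff_dim P) \<and>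
             ehrhart_series P = fps_of_poly h / (1 - fps_X) ^ (nat (aff_dim P) + 1))"

definition real_rooted :: "real poly \<Rightarrow> bool" where
  "real_rooted p \<longleftrightarrow> (\<forall>z::complex. poly (map_poly complex_of_real p) z = 0 \<longrightarrow> z \<in> \<real>)"

definition unimodal_with_middle_peak :: "nat \<Rightarrow> (nat \<Rightarrow> real) \<Rightarrow> bool" where
  "unimodal_with_middle_peak D h \<longleftrightarrow>
     (\<forall>i. i < D div 2 \<longrightarrow> h i \<le> h (i + 1)) \<and>
     (\<forall>i. D div 2 \<le> i \<and> i < D \<longrightarrow> h (i + 1) \<le> h i)"

end

theory Submission
  imports Defs
begin

text \<open>
  For \<open>d > 0\<close> the Laplacian matrix is, up to conjugation with a sign matrix, \<open>N I - J\<close> with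
  \<open>N = d + 2\<close> and \<open>J\<close> the all-ones matrix (for \<open>d = 0\<close> it vanishes instead). So a lattice point of \<open>n P\<close>
  is given by \<open>N\<close> natural numbers with sum \<open>n N\<close> whose signed sum is divisible by \<open>N\<close>.
  For odd \<open>d\<close> the coordinates of positive and of negative sign must separately have sums
  divisible by \<open>N\<close>, hence \<open>h\<^sup>*\<close> is the product of the two numerators of the \<open>N\<close>-th Veronese series of
  \<open>1 / (1 - t) ^ p\<close> with \<open>p = (N \<plusminus> 1) / 2\<close>. For even \<open>d\<close> the representation is unique only up to
  adding multiples of the sign vector; normalising it, one finds that \<open>h\<^sup>*\<close> consists of the even
  coefficients of \<open>(1 + t) ^ (N - 1) * h\<^sup>2\<close>, where \<open>h\<close> is the numerator of the \<open>N / 2\<close>-th Veronese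
  series of \<open>1 / (1 - t) ^ (N / 2)\<close>.

  The \<open>m\<close>-th Veronese numerators satisfy an Eulerian type recursion in \<open>p\<close> which preserves simple
  negative roots. Their coefficients are every \<open>m\<close>-th coefficient of \<open>(1 + t + \<dots> + t ^ (m - 1)) ^ p\<close>,
  which is symmetric and unimodal. So their superlevel sets are intervals with known midpoints up
  to rounding, and convolving such functions keeps the peak in the middle.
\<close>

section \<open>Veronese sections of power series\<close>

unbundle no vec_syntax

definition poly_section :: "nat \<Rightarrow> real poly \<Rightarrow> real poly" where
  "poly_section m p = (\<Sum>k\<le>degree p. monom (coeff p (k * m)) k)"

definition fps_section :: "nat \<Rightarrow> real fps \<Rightarrow> real fps" where
  "fps_section m F = Abs_fps (\<lambda>k. F $ (k * m))"

text \<open>The series 1/(1-t); multiplying by \<open>geo ^ p\<close> stands for dividing by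
  (1-t)^p.\<close>

definition geo :: "real fps" where
  "geo = Abs_fps (\<lambda>_. 1)"

definition gsum :: "nat \<Rightarrow> real poly" where
  "gsum m = (\<Sum>i<m. [:0, 1:] ^ i)"

text \<open>For \<open>m > 0\<close> this is the numerator, over (1-t)^p, of the series of every
  m-th coefficient of 1/(1-t)^p, as \<open>veronese_gf\<close> shows.\<close>

definition veronese :: "nat \<Rightarrow> nat \<Rightarrow> real poly" where
  "veronese m p = poly_section m (gsum m ^ p)"

lemma coeff_poly_section:
  assumes "m > 0"
  shows "coeff (poly_section m p) k = coeff p (k * m)"
proof -
  have "coeff p (k * m) = 0" if "k > degree p"
  proof (rule coeff_eq_0)
    have "k * 1 \<le> k * m" using assms by (intro mult_le_mono2) simp
    then show "degree p < k * m" using that by linarith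
  qed
  then show ?thesis
    unfolding poly_section_def by (auto simp: coeff_sum if_distrib cong: if_cong)
qed

lemma degree_poly_section:
  assumes "m > 0"
  shows "degree (poly_section m p) \<le> degree p div m"
proof (rule degree_le, intro allI impI)
  fix i assume "degree p div m < i"
  then have "degree p < i * m"
    using assms by (simp add: div_less_iff_less_mult)
  then show "coeff (poly_section m p) i = 0"
    by (simp add: coeff_poly_section assms coeff_eq_0)
qed

lemma fps_section_of_poly:
  "m > 0 \<Longrightarrow> fps_section m (fps_of_poly p) = fps_of_poly (poly_section m p)"
  by (simp add: fps_eq_iff fps_section_def coeff_poly_section)

text \<open>Taking every m-th coefficient turns multiplication by t^m into multiplication by
  t.\<close>

lemma fps_section_shift:
  assumes "m > 0"
  shows "(1 - fps_X) * fps_section m F = fps_section m ((1 - fps_X ^ m) * F)"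
proof (rule fps_ext)
  fix n
  show "((1 - fps_X) * fps_section m F) $ n = fps_section m ((1 - fps_X ^ m) * F) $ n"
  proof (cases n)
    case 0
    then show ?thesis using assms
      by (simp add: fps_section_def ring_distribs fps_X_power_mult_nth)
  next
    case (Suc k)
    then show ?thesis using assms
      by (simp add: fps_section_def ring_distribs fps_X_power_mult_nth)
  qed
qed

lemma fps_section_shift_power:
  assumes "m > 0"
  shows "(1 - fps_X) ^ p * fps_section m F = fps_section m ((1 - fps_X ^ m) ^ p * F)"
proof (induction p arbitrary: F)
  case (Suc p)
  have "(1 - fps_X) ^ Suc p * fps_section m F = (1 - fps_X) ^ p * ((1 - fps_X) * fps_section m F)"
    by (simp add: mult_ac)
  also have "\<dots> = fps_section m ((1 - fps_X ^ m) ^ Suc p * F)"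
    by (simp only: fps_section_shift[OF assms] Suc.IH power_Suc2 mult.assoc)
  finally show ?case .
qed simp

lemma one_minus_X_geo: "(1 - fps_X) * geo = 1"
proof (rule fps_ext)
  show "((1 - fps_X) * geo) $ n = (1 :: real fps) $ n" for n
    by (cases n) (simp_all add: geo_def ring_distribs)
qed

lemma one_minus_X_geo_power: "(1 - fps_X) ^ p * geo ^ p = 1"
  by (metis one_minus_X_geo power_mult_distrib power_one)

lemma fps_eq_times_geo:
  assumes "(1 - fps_X) ^ p * F = G"
  shows "F = G * geo ^ p"
  using assms one_minus_X_geo_power[of p] by (metis mult.assoc mult.commute mult_1)

lemma divide_one_minus_X_power: "F / (1 - fps_X) ^ p = F * geo ^ p"
proof -
  have "F = F * geo ^ p * (1 - fps_X) ^ p"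
    using one_minus_X_geo_power[of p] by (metis mult.assoc mult.commute mult_1)
  moreover have "(1 - fps_X :: real fps) ^ p \<noteq> 0"
    using one_minus_X_geo_power[of p] by auto
  ultimately show ?thesis
    by (metis nonzero_mult_div_cancel_right)
qed

lemma fps_of_gsum: "(1 - fps_X) * fps_of_poly (gsum m) = 1 - fps_X ^ m"
  unfolding gsum_def fps_of_poly_sum fps_of_poly_power
  by (simp add: fps_of_poly_fps_X one_diff_power_eq)

text \<open>The factor (1-t)^p outside the section becomes (1-t^m)^p inside it. Since (1-t^m)/(1-t)
  is \<open>gsum m\<close>, this leaves the polynomial \<open>gsum m ^ p\<close>.\<close>

lemma veronese_gf:
  assumes "m > 0"
  shows "fps_section m (geo ^ p) = fps_of_poly (veronese m p) * geo ^ p"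
proof (rule fps_eq_times_geo)
  have "(1 - fps_X ^ m) ^ p * geo ^ p = fps_of_poly (gsum m) ^ p * ((1 - fps_X) ^ p * geo ^ p)"
    by (simp add: fps_of_gsum[symmetric] power_mult_distrib mult_ac)
  also have "\<dots> = fps_of_poly (gsum m ^ p)"
    by (simp only: one_minus_X_geo_power fps_of_poly_power mult_1_right)
  finally have "(1 - fps_X ^ m) ^ p * geo ^ p = fps_of_poly (gsum m ^ p)" .
  then show "(1 - fps_X) ^ p * fps_section m (geo ^ p) = fps_of_poly (veronese m p)"
    by (simp add: fps_section_shift_power assms fps_section_of_poly veronese_def)
qed

lemma degree_gsum: "degree (gsum m) \<le> m - 1"
  unfolding gsum_def
proof (rule degree_sum_le)
  show "degree ([:0, 1:: real:] ^ i) \<le> m - 1" if "i \<in> {..<m}" for i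
    using that degree_power_le[of "[:0, 1:: real:]" i] by simp
qed simp

lemma degree_veronese:
  assumes "m > 0"
    and "p > 0"
  shows "degree (veronese m p) < p"
proof -
  have "degree (gsum m ^ p) \<le> (m - 1) * p"
    by (rule order.trans[OF degree_power_le mult_le_mono1[OF degree_gsum]])
  then have *: "degree (veronese m p) \<le> (m - 1) * p div m"
    unfolding veronese_def
    by (rule order.trans[OF degree_poly_section[OF assms(1)] div_le_mono])
  show ?thesis
    using assms by (intro le_less_trans[OF *]) (simp add: div_less_iff_less_mult)
qed

section \<open>Eulerian recursion for the Veronese numerators\<close>

lemma fps_deriv_geo: "fps_deriv geo = geo ^ 2"
proof -
  have "fps_deriv ((1 - fps_X) * geo) = 0"
    by (simp add: one_minus_X_geo)
  then have "(1 - fps_X) ^ 1 * fps_deriv geo = geo"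
    by (simp add: algebra_simps)
  from fps_eq_times_geo[OF this] show ?thesis by (simp add: power2_eq_square)
qed

lemma fps_deriv_geo_power: "fps_deriv (geo ^ p) = of_nat p * geo ^ Suc p"
proof (cases p)
  case (Suc k)
  show ?thesis
    by (subst fps_deriv_power', subst fps_deriv_geo)
      (simp only: Suc diff_Suc_1 power_Suc, simp only: power2_eq_square mult_ac)
qed simp

lemma geo_power_conv_Suc: "geo ^ p = (1 - fps_X) * geo ^ Suc p"
  by (simp only: power_Suc mult.assoc[symmetric] one_minus_X_geo mult_1_left)

text \<open>For \<open>p > 0\<close> this is the binomial identity (n+p) C(n+p-1, n) = p C(n+p, n),
  obtained by applying t d/dt + p to (1-t)^(-p).\<close>

lemma geo_power_Suc_nth:
  "(of_nat n + of_nat p) * (geo ^ p) $ n = of_nat p * (geo ^ Suc p) $ n"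
proof -
  have "fps_X * geo ^ Suc p + geo ^ p = geo ^ Suc p"
    by (subst (2) geo_power_conv_Suc) (simp add: algebra_simps del: power_Suc)
  moreover have "fps_X * fps_deriv (geo ^ p) + fps_const (of_nat p) * geo ^ p
      = fps_const (of_nat p) * (fps_X * geo ^ Suc p + geo ^ p)"
    unfolding fps_deriv_geo_power fps_of_nat[symmetric] by (simp only: algebra_simps)
  ultimately have "(fps_X * fps_deriv (geo ^ p) + fps_const (of_nat p) * geo ^ p) $ n
      = (fps_const (of_nat p) * geo ^ Suc p) $ n"
    by (simp only:)
  moreover have "(fps_X * fps_deriv (geo ^ p)) $ n = of_nat n * (geo ^ p) $ n"
    by (cases n) (simp_all del: fps_deriv_power)
  ultimately show ?thesis
    by (simp only: fps_add_nth fps_mult_left_const_nth distrib_right)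
qed

lemma veronese_1: "m > 0 \<Longrightarrow> veronese m 1 = 1"
proof -
  assume "m > 0"
  have "fps_section m (geo ^ 1) = 1 * geo ^ 1"
    by (simp add: fps_eq_iff fps_section_def geo_def)
  then have "fps_of_poly (veronese m 1) * geo ^ 1 = fps_of_poly 1 * geo ^ 1"
    using veronese_gf[OF \<open>m > 0\<close>, of 1] by simp
  then have "fps_of_poly (veronese m 1) = fps_of_poly 1"
    using one_minus_X_geo by auto
  then show ?thesis by (simp only: fps_of_poly_eq_iff)
qed

text \<open>\<open>geo_power_Suc_nth\<close> at the index n m says that m t d/dt + p carries the
  section of \<open>geo ^ p\<close> to p times the section of \<open>geo ^ Suc p\<close>. Writing
  both as numerators times powers of \<open>geo\<close> gives the recursion.\<close>

lemma veronese_Suc: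
  assumes "m > 0" "p > 0"
  shows "veronese m (Suc p) =
    smult (m / p) ([:0, 1, -1:] * pderiv (veronese m p)) + [:1, of_nat m - 1:] * veronese m p"
proof -
  define W where "W = fps_of_poly (veronese m p)"
  define V where "V = fps_of_poly (veronese m (Suc p))"
  have "of_nat m * (fps_X * fps_deriv (W * geo ^ p)) + of_nat p * (W * geo ^ p) = of_nat p * (V * geo ^ Suc p)"
    unfolding W_def V_def veronese_gf[OF assms(1), symmetric]
  proof (rule fps_ext)
    fix n
    have "(fps_X * fps_deriv (fps_section m (geo ^ p))) $ n = of_nat n * (geo ^ p) $ (n * m)"
      by (cases n) (simp_all add: fps_section_def mult_ac del: fps_deriv_power)
    then show "(of_nat m * (fps_X * fps_deriv (fps_section m (geo ^ p)))
        + of_nat p * fps_section m (geo ^ p)) $ n = (of_nat p * fps_section m (geo ^ Suc p)) $ n"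
      using geo_power_Suc_nth[of "n * m"]
      unfolding fps_of_nat[symmetric] fps_add_nth fps_mult_left_const_nth
      by (simp add: fps_section_def algebra_simps del: power_Suc)
  qed
  also have "fps_deriv (W * geo ^ p) = fps_deriv W * geo ^ p + of_nat p * W * geo ^ Suc p"
    by (simp add: fps_deriv_geo_power mult_ac del: fps_deriv_power power_Suc)
  \<comment> \<open>Writing \<open>geo ^ p\<close> as (1-t) \<open>geo ^ Suc p\<close> exposes a
    common factor to cancel.\<close>
  also have "of_nat m * (fps_X * (fps_deriv W * geo ^ p + of_nat p * W * geo ^ Suc p)) + of_nat p * (W * geo ^ p)
    = (of_nat m * fps_X * (1 - fps_X) * fps_deriv W + of_nat p * (1 + (of_nat m - 1) * fps_X) * W) * geo ^ Suc p"
    unfolding geo_power_conv_Suc[of p] by (simp add: algebra_simps del: power_Suc)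
  finally have "(of_nat m * fps_X * (1 - fps_X) * fps_deriv W + of_nat p * (1 + (of_nat m - 1) * fps_X) * W) * geo ^ Suc p
     = of_nat p * V * geo ^ Suc p"
    by (simp only: mult.assoc)
  moreover have "geo ^ Suc p \<noteq> 0"
    using one_minus_X_geo_power[of "Suc p"] by auto
  ultimately have "of_nat p * V = of_nat m * fps_X * (1 - fps_X) * fps_deriv W + of_nat p * (1 + (of_nat m - 1) * fps_X) * W"
    by (simp del: power_Suc)
  also have "\<dots> = fps_of_poly (smult (of_nat m) ([:0, 1, -1:] * pderiv (veronese m p)) + smult (of_nat p) ([:1, of_nat m - 1:] * veronese m p))"
  proof -
    have "fps_of_poly [:0, 1, -1 :: real:] = fps_X * (1 - fps_X)"
      by (simp add: fps_of_poly_pCons algebra_simps flip: fps_const_neg)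
    moreover have "fps_of_poly [:1, of_nat m - 1 :: real:] = 1 + (of_nat m - 1) * fps_X"
      unfolding fps_of_poly_pCons fps_const_sub[symmetric] fps_of_nat by simp
    ultimately show ?thesis
      unfolding W_def fps_of_poly_add fps_of_poly_smult fps_of_poly_mult fps_of_poly_pderiv fps_of_nat
      by (simp only: mult_ac)
  qed
  also have "of_nat p * V = fps_of_poly (smult (of_nat p) (veronese m (Suc p)))"
    by (simp only: V_def fps_of_poly_smult fps_of_nat)
  finally have "smult (of_nat p) (veronese m (Suc p)) = smult (of_nat m) ([:0, 1, -1:] * pderiv (veronese m p)) + smult (of_nat p) ([:1, of_nat m - 1:] * veronese m p)"
    by (simp only: fps_of_poly_eq_iff)
  then have "smult (1 / of_nat p) (smult (of_nat p) (veronese m (Suc p))) = smult (1 / of_nat p) (smult (of_nat m) ([:0, 1, -1:] * pderiv (veronese m p)) + smult (of_nat p) ([:1, of_nat m - 1:] * veronese m p))"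
    by (rule arg_cong)
  moreover have "1 / of_nat p * of_nat p = (1 :: real)" "1 / of_nat p * of_nat m = m / p"
    using assms(2) by simp_all
  ultimately show ?thesis
    by (simp only: smult_add_right smult_smult smult_1_left)
qed

section \<open>Real roots of the numerators\<close>

text \<open>There are as many distinct roots as the degree, so these are all roots and each is
  simple. The increasing enumeration makes the sign of the derivative at each root explicit.\<close>

definition simple_negative_roots :: "real poly \<Rightarrow> bool" where
  "simple_negative_roots W \<longleftrightarrow> lead_coeff W > 0 \<and>
     (\<exists>x. strict_mono_on {..<degree W} x \<and> (\<forall>i<degree W. x i < 0 \<and> poly W (x i) = 0))"

lemma poly_eq_prod_roots:
  fixes W :: "'a::idom poly"
  assumes "inj_on x {..<degree W}" and "\<And>i. i < degree W \<Longrightarrow> poly W (x i) = 0"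
  shows "W = smult (lead_coeff W) (\<Prod>i<degree W. [:- x i, 1:])"
proof (rule poly_eqI_degree_lead_coeff[where n = "degree W" and A = "x ` {..<degree W}"])
  have "degree (\<Prod>i<degree W. [:- x i, 1:]) = degree W"
    by (subst degree_prod_eq_sum_degree) simp_all
  moreover have "lead_coeff (\<Prod>i<degree W. [:- x i, 1:]) = 1"
    by (simp add: lead_coeff_prod)
  ultimately show "coeff W (degree W) = coeff (smult (lead_coeff W) (\<Prod>i<degree W. [:- x i, 1:])) (degree W)"
    and "degree (smult (lead_coeff W) (\<Prod>i<degree W. [:- x i, 1:])) \<le> degree W"
    by auto
  show "poly W z = poly (smult (lead_coeff W) (\<Prod>i<degree W. [:- x i, 1:])) z"
    if "z \<in> x ` {..<degree W}" for z
    using that assms(2) by (auto simp: poly_prod)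
qed (use assms(1) in \<open>simp_all add: card_image\<close>)

text \<open>The derivative at x_i is the leading coefficient times the product of x_i - x_j over j
  other than i; exactly the \<open>degree W - Suc i\<close> factors with j > i are negative.\<close>

lemma pderiv_sign_at_root:
  fixes W :: "real poly"
  assumes "lead_coeff W > 0" and x: "strict_mono_on {..<degree W} x"
    and roots: "\<And>i. i < degree W \<Longrightarrow> poly W (x i) = 0" and i: "i < degree W"
  shows "(-1) ^ (degree W - Suc i) * poly (pderiv W) (x i) > 0"
proof -
  define k where "k = degree W"
  define F where "F = (\<lambda>j. [:- x j, 1:])"
  have "W = smult (lead_coeff W) (prod F {..<k})"
    unfolding k_def F_def
    using strict_mono_on_imp_inj_on[OF x] roots by (rule poly_eq_prod_roots)
  then have "poly (pderiv W) (x i) = lead_coeff W * poly (pderiv (prod F {..<k})) (x i)"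
    by (metis pderiv_smult poly_smult)
  also have "poly (pderiv (prod F {..<k})) (x i) =
      (\<Sum>a<k. \<Prod>j\<in>{..<k} - {a}. x i - x j)"
    by (simp add: pderiv_prod poly_sum poly_prod F_def pderiv_pCons)
  \<comment> \<open>Every summand with a different from i retains the factor x_i - x_i.\<close>
  also have "\<dots> = (\<Sum>a\<in>{i}. \<Prod>j\<in>{..<k} - {a}. x i - x j)"
    using i by (intro sum.mono_neutral_right) (auto simp: k_def)
  also have "\<dots> = (\<Prod>j\<in>{..<i} \<union> {i<..<k}. x i - x j)"
    using i by (simp, intro prod.cong) (auto simp: k_def)
  also have "\<dots> = (\<Prod>j<i. x i - x j) * (\<Prod>j\<in>{i<..<k}. x i - x j)"
    by (rule prod.union_disjoint) auto
  also have "(\<Prod>j\<in>{i<..<k}. x i - x j) = (-1) ^ (k - Suc i) * (\<Prod>j\<in>{i<..<k}. x j - x i)"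
  proof -
    have "(\<Prod>j\<in>{i<..<k}. x i - x j) = (\<Prod>j\<in>{i<..<k}. (-1) * (x j - x i))"
      by simp
    then show ?thesis
      by (simp only: prod.distrib) simp
  qed
  finally have "(-1) ^ (k - Suc i) * poly (pderiv W) (x i)
      = lead_coeff W * (\<Prod>j<i. x i - x j) * (\<Prod>j\<in>{i<..<k}. x j - x i)"
    by simp
  moreover have "(\<Prod>j<i. x i - x j) > 0" "(\<Prod>j\<in>{i<..<k}. x j - x i) > 0"
    using i x by (auto intro!: prod_pos simp: k_def strict_mono_on_def)
  ultimately show ?thesis
    using assms(1) by (simp add: k_def)
qed

lemma poly_sign_at_bot:
  fixes V :: "real poly"
  assumes "lead_coeff V > 0"
  shows "\<exists>t<b. (-1) ^ degree V * poly V t > 0"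
proof -
  \<comment> \<open>Reflecting at 0 and correcting the sign keeps the leading coefficient, so the
    behaviour at plus infinity can be used.\<close>
  define Q where "Q = smult ((-1) ^ degree V) (V \<circ>\<^sub>p [:0, -1:])"
  have "lead_coeff Q = lead_coeff V * ((-1) ^ degree V * (-1) ^ degree V)"
    unfolding Q_def lead_coeff_smult by (subst lead_coeff_comp) simp_all
  also have "\<dots> = lead_coeff V"
    by (simp flip: power_mult_distrib)
  finally have "lead_coeff Q = lead_coeff V" .
  then have "lead_coeff Q > 0"
    using assms by simp
  from poly_pinfty_gt_lc[OF this] obtain n where n: "\<And>x. x \<ge> n \<Longrightarrow> poly Q x \<ge> lead_coeff Q"
    by blast
  have "poly Q (max n (1 - b)) > 0"
    using n[of "max n (1 - b)"] \<open>lead_coeff Q > 0\<close> by linarith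
  then show ?thesis
    by (intro exI[of _ "- max n (1 - b)"]) (auto simp: Q_def poly_pcompose)
qed

text \<open>
  Between two consecutive roots of \<open>W\<close>, the sign of \<open>W'\<close> and hence of the new polynomial
  changes; two further sign changes occur next to \<open>0\<close> and \<open>-\<infinity>\<close>.
\<close>

lemma simple_negative_roots_step:
  fixes a b :: real
  assumes W: "simple_negative_roots W" and "0 < a" "a * degree W < b"
  defines "V \<equiv> smult a ([:0, 1, -1:] * pderiv W) + [:1, b:] * W"
  shows "degree V = Suc (degree W) \<and> simple_negative_roots V"
proof -
  define k where "k = degree W"
  obtain x where x: "strict_mono_on {..<k} x"
    and neg: "\<And>i. i < k \<Longrightarrow> x i < 0" and roots: "\<And>i. i < k \<Longrightarrow> poly W (x i) = 0"
    using W unfolding simple_negative_roots_def k_def by blast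
  have lc: "lead_coeff W > 0"
    using W by (simp add: simple_negative_roots_def)
  have "degree V \<le> Suc k"
  proof (rule degree_le, intro allI impI)
    fix i assume "Suc k < i"
    then have "i = Suc (Suc (i - 2))" "k < Suc (i - 2)"
      by arith+
    then obtain j where j: "i = Suc (Suc j)" "k < Suc j"
      by blast
    then have "coeff W (Suc j) = 0" "coeff W (Suc (Suc j)) = 0"
      by (auto simp: k_def intro!: coeff_eq_0)
    then show "coeff V i = 0"
      by (simp add: V_def coeff_pderiv j(1))
  qed
  \<comment> \<open>The top terms -a t^2 W' and b t W contribute -a k and b times the leading
    coefficient; hence the hypothesis \<open>a * degree W < b\<close>.\<close>
  have coeff: "coeff V (Suc k) = (b - a * k) * lead_coeff W"
  proof -
    have "coeff W (Suc k) = 0"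
      by (simp add: k_def coeff_eq_0)
    then show ?thesis
      by (cases k) (simp_all add: V_def coeff_pderiv algebra_simps flip: k_def)
  qed
  also have "\<dots> > 0"
    using assms(3) lc by (simp add: k_def)
  finally have pos: "coeff V (Suc k) > 0" .
  then have deg: "degree V = Suc k"
    using \<open>degree V \<le> Suc k\<close> by (intro antisym le_degree) simp_all
  \<comment> \<open>For constant \<open>W\<close> there is no root \<open>x 0\<close>, and
    \<open>t\<close> only has to lie below 0.\<close>
  obtain t where t: "t < (if k = 0 then 0 else x 0)" "(-1) ^ Suc k * poly V t > 0"
    using poly_sign_at_bot[of V] pos unfolding deg by blast
  \<comment> \<open>The k + 2 test points: a point far to the left, the roots of \<open>W\<close>,
    and 0.\<close>
  define z where "z = (\<lambda>i. if i = 0 then t else if i = Suc k then 0 else x (i - 1))"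
  have z: "z i < z (Suc i)" if "i < Suc k" for i
    using that t(1) neg strict_mono_onD[OF x, of "i - 1" i] by (auto simp: z_def)
  \<comment> \<open>The signs of \<open>V\<close> alternate along the test points, ending with a
    positive value at 0.\<close>
  have sign: "(-1) ^ (Suc k - i) * poly V (z i) > 0" if i: "i \<le> Suc k" for i
  proof -
    consider "i = 0" | "i = Suc k" | j where "i = Suc j" "j < k"
      using i by (cases i) (auto simp: le_less)
    then show ?thesis
    proof cases
      case 1
      then show ?thesis using t(2) by (simp add: z_def)
    next
      case 2
      have "W = smult (lead_coeff W) (\<Prod>i<k. [:- x i, 1:])"
        unfolding k_def
        by (rule poly_eq_prod_roots) (use x roots in \<open>auto simp: k_def intro: strict_mono_on_imp_inj_on\<close>)
      from arg_cong[OF this, of "\<lambda>q. poly q 0"]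
      have "poly W 0 = lead_coeff W * (\<Prod>i<k. - x i)"
        by (simp add: poly_prod)
      also have "\<dots> > 0"
        using lc neg by (intro mult_pos_pos prod_pos) auto
      finally show ?thesis using 2 by (simp add: V_def z_def)
    next
      case 3
      \<comment> \<open>At a root of \<open>W\<close> only the derivative term survives, and its
        factor x (1-x) is negative, which flips the sign of the derivative.\<close>
      have "poly V (z i) = a * (x j * (1 - x j)) * poly (pderiv W) (x j)"
        using 3 roots[of j] by (simp add: V_def z_def algebra_simps)
      moreover have "(-1) ^ (Suc k - i) = - ((-1 :: real) ^ (k - Suc j))"
      proof -
        have "Suc k - i = Suc (k - Suc j)"
          using 3 by arith
        then show ?thesis by simp
      qed
      ultimately have "(-1) ^ (Suc k - i) * poly V (z i)
          = (a * (- x j) * (1 - x j)) * ((-1) ^ (k - Suc j) * poly (pderiv W) (x j))"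
        by (simp add: mult_ac)
      moreover have "a * (- x j) * (1 - x j) > 0"
        using neg[of j] 3 assms(2) by (intro mult_pos_pos) auto
      moreover have "(-1) ^ (k - Suc j) * poly (pderiv W) (x j) > 0"
        using pderiv_sign_at_root[OF lc, of x j] x roots 3 by (simp add: k_def)
      ultimately show ?thesis
        by (metis mult_pos_pos)
    qed
  qed
  \<comment> \<open>Each of the k + 1 gaps contains a root of \<open>V\<close>, as many as its
    degree.\<close>
  have "\<exists>y. z i < y \<and> y < z (Suc i) \<and> poly V y = 0" if "i < Suc k" for i
  proof (rule poly_IVT)
    have "0 < ((-1) ^ (Suc k - i) * poly V (z i)) * ((-1) ^ (Suc k - Suc i) * poly V (z (Suc i)))"
      using that by (intro mult_pos_pos sign) auto
    also have "\<dots> = ((-1) ^ (k - i) * (-1) ^ (k - i)) * - (poly V (z i) * poly V (z (Suc i)))"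
      using that by (simp only: Suc_diff_le less_Suc_eq_le power_Suc diff_Suc_Suc) (simp only: mult_ac mult_minus_left mult_minus_right mult_1_left)
    finally show "poly V (z i) * poly V (z (Suc i)) < 0"
      by (simp flip: power_mult_distrib)
  qed (use z that in auto)
  then obtain y where y: "\<And>i. i < Suc k \<Longrightarrow> z i < y i \<and> y i < z (Suc i) \<and> poly V (y i) = 0"
    by metis
  have z_mono: "z i \<le> z j" if "i \<le> j" "j \<le> Suc k" for i j
    using that
  proof (induction rule: dec_induct)
    case (step n)
    then show ?case using z[of n] by fastforce
  qed simp
  have "strict_mono_on {..<Suc k} y"
  proof (rule strict_mono_onI)
    fix i j assume "i \<in> {..<Suc k}" "j \<in> {..<Suc k}" "i < j"
    then show "y i < y j"
      using y[of i] y[of j] z_mono[of "Suc i" j] by simp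
  qed
  moreover have "y i < 0" if "i < Suc k" for i
    using y[OF that] z_mono[of "Suc i" "Suc k"] that by (auto simp: z_def)
  ultimately have "strict_mono_on {..<Suc k} y \<and> (\<forall>i<Suc k. y i < 0 \<and> poly V (y i) = 0)"
    using y by simp
  then show ?thesis
    unfolding simple_negative_roots_def deg k_def[symmetric] using pos by auto
qed

text \<open>The induction step needs m (p-1)/p < m - 1, that is p < m; hence the bound
  \<open>p \<le> m\<close>.\<close>

lemma simple_negative_roots_veronese:
  assumes "0 < p" "p \<le> m"
  shows "degree (veronese m p) = p - 1 \<and> simple_negative_roots (veronese m p)"
  using assms
proof (induction p rule: nat_induct_non_zero)
  case 1
  then show ?case by (simp add: veronese_1[simplified] simple_negative_roots_def)
next
  case (Suc p)
  then have IH: "degree (veronese m p) = p - 1" "simple_negative_roots (veronese m p)"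
    by simp_all
  have "real m * real (p - 1) / real p < real m - 1"
    using Suc by (simp add: field_simps of_nat_diff)
  then show ?case
    using simple_negative_roots_step[OF IH(2), of "real m / real p" "of_nat m - 1"] Suc
    by (simp add: veronese_Suc IH(1))
qed

lemma map_poly_of_real_mult:
  "map_poly complex_of_real (p * q) = map_poly of_real p * map_poly of_real q"
  by (rule poly_eqI) (simp add: coeff_map_poly coeff_mult)

lemma real_rooted_mult: "real_rooted p \<Longrightarrow> real_rooted q \<Longrightarrow> real_rooted (p * q)"
  by (auto simp: real_rooted_def map_poly_of_real_mult)

lemma simple_negative_roots_imp_real_rooted:
  assumes "simple_negative_roots W"
  shows "real_rooted W"
proof -
  obtain x where "strict_mono_on {..<degree W} x" and "\<And>i. i < degree W \<Longrightarrow> poly W (x i) = 0"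
    and lc: "lead_coeff W > 0"
    using assms unfolding simple_negative_roots_def by blast
  then have "W = smult (lead_coeff W) (\<Prod>i<degree W. [:- x i, 1:])"
    by (intro poly_eq_prod_roots strict_mono_on_imp_inj_on)
  also have "\<dots> = [:lead_coeff W:] * (\<Prod>i<degree W. [:- x i, 1:])"
    by simp
  also have "real_rooted \<dots>"
  proof (rule real_rooted_mult)
    show "real_rooted [:lead_coeff W:]"
      using lc by (auto simp: real_rooted_def map_poly_pCons)
    have "real_rooted (\<Prod>i<n. [:- x i, 1:])" for n
    proof (induction n)
      case 0
      then show ?case by (simp add: real_rooted_def)
    next
      case (Suc n)
      have "real_rooted [:- x n, 1:]"
        unfolding real_rooted_def
      proof (intro allI impI)
        fix z assume "poly (map_poly complex_of_real [:- x n, 1:]) z = 0"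
        then have "z - complex_of_real (x n) = 0"
          by (simp add: map_poly_pCons)
        then show "z \<in> \<real>" by simp
      qed
      with Suc show ?case
        by (simp add: real_rooted_mult del: mult_pCons_right)
    qed
    then show "real_rooted (\<Prod>i<degree W. [:- x i, 1:])" .
  qed
  finally show ?thesis .
qed

section \<open>Unimodality\<close>

text \<open>Extension by zero to all integers frees shifts and reflections of the index from side
  conditions.\<close>

definition icoeff :: "real poly \<Rightarrow> int \<Rightarrow> real" where
  "icoeff p z = (if z < 0 then 0 else coeff p (nat z))"

text \<open>
  \<open>f\<close> is unimodal and decreases with the distance from the point \<open>c / 2\<close>, which need not be
  a half-integer.
\<close>

definition peaked :: "real \<Rightarrow> (int \<Rightarrow> real) \<Rightarrow> bool" where
  "peaked c f \<longleftrightarrow> (\<forall>x y. x \<le> y \<longrightarrow>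
     (of_int (x + y) \<le> c \<longrightarrow> f x \<le> f y) \<and> (c \<le> of_int (x + y) \<longrightarrow> f y \<le> f x))"

lemma peakedD1: "peaked c f \<Longrightarrow> x \<le> y \<Longrightarrow> of_int (x + y) \<le> c \<Longrightarrow> f x \<le> f y"
  and peakedD2: "peaked c f \<Longrightarrow> x \<le> y \<Longrightarrow> c \<le> of_int (x + y) \<Longrightarrow> f y \<le> f x"
  by (auto simp: peaked_def)

text \<open>The indices z and c - z sum to exactly c, so both inequalities of \<open>peaked\<close>
  apply to them.\<close>

lemma peaked_reflect:
  assumes "peaked (of_int c) f"
  shows "f (c - z) = f z"
proof (cases "z \<le> c - z")
  case True
  then show ?thesis
    using peakedD1[OF assms, of z "c - z"] peakedD2[OF assms, of z "c - z"] by simp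
next
  case False
  then show ?thesis
    using peakedD1[OF assms, of "c - z" z] peakedD2[OF assms, of "c - z" z] by simp
qed

text \<open>Reflection carries the increasing half to the decreasing one, so unit steps up to the
  middle suffice.\<close>

lemma peakedI:
  assumes sym: "\<And>z. f (c - z) = f z" and inc: "\<And>z. 2 * z + 1 \<le> c \<Longrightarrow> f z \<le> f (z + 1)"
  shows "peaked (of_int c) f"
proof -
  have half: "f x \<le> f y" if "x \<le> y" "2 * y \<le> c + 1" for x y
    using that
  proof (induction y rule: int_ge_induct)
    case (step i)
    then show ?case using inc[of i] by simp
  qed simp
  \<comment> \<open>A point y beyond the middle is replaced by its mirror image c - y, which is
    still at least x.\<close>
  have left: "f x \<le> f y" if "x \<le> y" "x + y \<le> c" for x y
  proof (cases "2 * y \<le> c + 1")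
    case False
    then show ?thesis using half[of x "c - y"] that sym[of y] by simp
  qed (use half that in simp)
  have "f y \<le> f x" if "x \<le> y" "c \<le> x + y" for x y
    using left[of "c - y" "c - x"] that sym[of x] sym[of y] by simp
  with left show ?thesis by (auto simp: peaked_def)
qed

text \<open>Moving the window by one adds f (z + 1) and drops f (z - k) with k = m - 1; these
  indices sum to at most c exactly in the left half of the new range.\<close>

lemma peaked_window:
  assumes f: "peaked (of_int c) f" and "m > 0"
  shows "peaked (of_int (c + int m - 1)) (\<lambda>z. \<Sum>i<m. f (z - int i))"
proof (rule peakedI)
  fix z
  have "(\<Sum>i<m. f (c + int m - 1 - z - int i)) = (\<Sum>i<m. f (z - int (m - 1 - i)))"
  proof (rule sum.cong)
    fix i assume "i \<in> {..<m}"
    then have "c - (c + int m - 1 - z - int i) = z - int (m - 1 - i)"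
      by (simp add: of_nat_diff)
    then show "f (c + int m - 1 - z - int i) = f (z - int (m - 1 - i))"
      using peaked_reflect[OF f] by metis
  qed simp
  also have "\<dots> = (\<Sum>i<m. f (z - int i))"
    by (rule sum.reindex_bij_witness[of _ "\<lambda>i. m - 1 - i" "\<lambda>i. m - 1 - i"]) auto
  finally show "(\<Sum>i<m. f (c + int m - 1 - z - int i)) = (\<Sum>i<m. f (z - int i))" .
next
  fix z assume z: "2 * z + 1 \<le> c + int m - 1"
  obtain k where k: "m = Suc k" using \<open>m > 0\<close> gr0_implies_Suc by blast
  have "(\<Sum>i<m. f (z + 1 - int i)) = f (z + 1) + (\<Sum>i<k. f (z - int i))"
    unfolding k by (subst sum.lessThan_Suc_shift) (simp add: algebra_simps)
  moreover have "f (z - int k) \<le> f (z + 1)"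
    using z k by (intro peakedD1[OF f]) (auto simp flip: of_int_add)
  ultimately show "(\<Sum>i<m. f (z - int i)) \<le> (\<Sum>i<m. f (z + 1 - int i))"
    by (simp add: k)
qed

lemma icoeff_gsum_mult: "icoeff (gsum m * p) z = (\<Sum>i<m. icoeff p (z - int i))"
proof -
  have "icoeff ([:0, 1:] ^ i * p) z = icoeff p (z - int i)" for i
  proof -
    have "[:0, 1 :: real:] ^ i = monom 1 i"
      by (simp add: monom_altdef)
    then show ?thesis
      by (auto simp: icoeff_def coeff_monom_mult nat_diff_distrib)
  qed
  moreover have "icoeff (\<Sum>i<m. Q i) z = (\<Sum>i<m. icoeff (Q i) z)" for Q
    by (simp add: icoeff_def coeff_sum)
  ultimately show ?thesis
    by (simp add: gsum_def sum_distrib_right)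
qed

lemma peaked_gsum_power_mult:
  assumes "m > 0" "peaked (of_int c) (icoeff p)"
  shows "peaked (of_int (c + int n * (int m - 1))) (icoeff (gsum m ^ n * p))"
proof (induction n)
  case (Suc n)
  have "icoeff (gsum m ^ Suc n * p) = (\<lambda>z. \<Sum>i<m. icoeff (gsum m ^ n * p) (z - int i))"
    by (rule ext) (simp only: icoeff_gsum_mult[symmetric] power_Suc mult.assoc)
  moreover have "c + int (Suc n) * (int m - 1) = c + int n * (int m - 1) + int m - 1"
    by (simp add: algebra_simps)
  ultimately show ?case
    using peaked_window[OF Suc assms(1)] by (simp only:)
qed (use assms in simp)

lemma icoeff_gsum_power_mult_nonneg:
  assumes "\<And>z. icoeff p z \<ge> 0"
  shows "icoeff (gsum m ^ n * p) z \<ge> 0"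
proof (induction n arbitrary: z)
  case (Suc n)
  have "icoeff (gsum m ^ Suc n * p) z = (\<Sum>i<m. icoeff (gsum m ^ n * p) (z - int i))"
    by (simp only: icoeff_gsum_mult[symmetric] power_Suc mult.assoc)
  also have "\<dots> \<ge> 0"
    using Suc by (intro sum_nonneg) auto
  finally show ?case .
qed (use assms in simp)

lemma icoeff_1: "icoeff 1 z = (if z = 0 then 1 else 0)"
  by (auto simp: icoeff_def coeff_1)

lemma peaked_gsum_power:
  assumes "m > 0"
  shows "peaked (of_int (int n * (int m - 1))) (icoeff (gsum m ^ n))"
proof -
  have "peaked (of_int 0) (icoeff 1)"
    by (rule peakedI) (auto simp: icoeff_1)
  from peaked_gsum_power_mult[OF assms this, of n] show ?thesis by simp
qed

lemma icoeff_poly_section: "m > 0 \<Longrightarrow> icoeff (poly_section m p) z = icoeff p (z * int m)"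
  by (auto simp: icoeff_def coeff_poly_section nat_mult_distrib mult_less_0_iff)

text \<open>Sampling every m-th coefficient divides the centre of \<open>gsum m ^ n\<close> by m, so
  it is no longer a half-integer in general; this is why \<open>peaked\<close> takes a real
  \<open>c\<close>.\<close>

lemma peaked_veronese:
  assumes "m > 0"
  shows "peaked (real n * (real m - 1) / real m) (icoeff (veronese m n))"
  unfolding peaked_def veronese_def icoeff_poly_section[OF assms]
proof (intro allI impI)
  fix x y :: int assume "x \<le> y"
  then have xy: "x * int m \<le> y * int m"
    by (simp add: mult_right_mono)
  note gsum = peaked_gsum_power[OF assms, of n]
  show "(real_of_int (x + y) \<le> real n * (real m - 1) / real m \<longrightarrow>
      icoeff (gsum m ^ n) (x * int m) \<le> icoeff (gsum m ^ n) (y * int m)) \<and>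
    (real n * (real m - 1) / real m \<le> real_of_int (x + y) \<longrightarrow>
      icoeff (gsum m ^ n) (y * int m) \<le> icoeff (gsum m ^ n) (x * int m))"
    using assms peakedD1[OF gsum xy] peakedD2[OF gsum xy] by (simp add: field_simps)
qed

lemma icoeff_veronese_nonneg: "m > 0 \<Longrightarrow> icoeff (veronese m n) z \<ge> 0"
  using icoeff_gsum_power_mult_nonneg[of 1 m n "z * int m"]
  by (simp add: veronese_def icoeff_poly_section icoeff_1)

text \<open>
  A peaked function is a nonnegative combination of indicator functions of its superlevel
  sets, which are intervals with midpoints close to \<open>c / 2\<close>.
\<close>

lemma peaked_sum_nonneg:
  fixes D :: "int \<Rightarrow> real"
  assumes "peaked c f" "\<And>i. f i \<ge> 0" "finite {i. f i \<noteq> 0}"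
    and D: "\<And>a b. a \<le> b \<Longrightarrow> c - 1 < of_int (a + b) \<Longrightarrow> of_int (a + b) < c + 1 \<Longrightarrow> (\<Sum>i=a..b. D i) \<ge> 0"
  shows "(\<Sum>i | f i \<noteq> 0. f i * D i) \<ge> 0"
  using assms(1-3)
proof (induction "card {i. f i \<noteq> 0}" arbitrary: f rule: less_induct)
  case less
  define S where "S = {i. f i \<noteq> 0}"
  have S: "finite S" using less.prems by (simp add: S_def)
  show ?case
  proof (cases "S = {}")
    case False
    define a b v where "a = Min S" and "b = Max S" and "v = Min (f ` S)"
    have mem: "a \<in> S" "b \<in> S" and "a \<le> b"
      using S False by (simp_all add: a_def b_def)
    have S_sub: "S \<subseteq> {a..b}"
      using S by (auto simp: a_def b_def)
    have pos: "f i > 0 \<longleftrightarrow> i \<in> S" for i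
      using less.prems(2)[of i] by (auto simp: S_def)
    \<comment> \<open>The support has no gaps: i is compared with the left end if
      \<open>a + i\<close> is at most c, and with the right end otherwise.\<close>
    have "i \<in> S" if "a \<le> i" "i \<le> b" for i
    proof (cases "of_int (a + i) \<le> c")
      case True
      then show ?thesis
        using peakedD1[OF less.prems(1) that(1)] mem pos by (meson less_le_trans)
    next
      case False
      moreover have "a + i \<le> i + b" using \<open>a \<le> b\<close> by simp
      then have "real_of_int (a + i) \<le> of_int (i + b)" by linarith
      ultimately show ?thesis
        using peakedD2[OF less.prems(1) that(2)] mem pos by (meson less_le_trans linear order_trans)
    qed
    then have S_eq: "S = {a..b}" using S_sub by auto
    \<comment> \<open>As a - 1 and b + 1 lie outside the support, a + b differs from c by less than
      1.\<close>
    have "\<not> c \<le> of_int ((a - 1) + b)"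
      using peakedD2[OF less.prems(1), of "a - 1" b] mem pos[of b] pos[of "a - 1"] S_sub \<open>a \<le> b\<close> by fastforce
    moreover have "\<not> of_int (a + (b + 1)) \<le> c"
      using peakedD1[OF less.prems(1), of a "b + 1"] mem pos[of a] pos[of "b + 1"] S_sub \<open>a \<le> b\<close> by fastforce
    ultimately have D_nonneg: "(\<Sum>i\<in>S. D i) \<ge> 0"
      unfolding S_eq using \<open>a \<le> b\<close> by (intro D) auto
    have v: "v \<in> f ` S" "\<And>i. i \<in> S \<Longrightarrow> v \<le> f i"
      using S False by (auto simp: v_def)
    then have "v > 0" using pos by auto
    \<comment> \<open>Removing the bottom layer of height v kills the points where f attains v, so
      the support shrinks; the maximum with 0 keeps g at 0 outside the support.\<close>
    define g where "g = (\<lambda>i. max 0 (f i - v))"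
    have g_supp: "{i. g i \<noteq> 0} \<subseteq> S"
      using \<open>v > 0\<close> by (auto simp: g_def S_def)
    have g_S: "g i = f i - v" if "i \<in> S" for i
      using v(2)[OF that] by (simp add: g_def)
    obtain j where "j \<in> S" "f j = v" using v(1) by auto
    then have "g j = 0" by (simp add: g_def)
    then have "{i. g i \<noteq> 0} \<subset> S"
      using g_supp \<open>j \<in> S\<close> by auto
    then have "card {i. g i \<noteq> 0} < card {i. f i \<noteq> 0}"
      using S by (simp add: psubset_card_mono flip: S_def)
    then have "(\<Sum>i | g i \<noteq> 0. g i * D i) \<ge> 0"
    proof (rule less.hyps)
      show "peaked c g"
        using less.prems(1) by (fastforce simp: peaked_def g_def)
      show "finite {i. g i \<noteq> 0}"
        using g_supp S by (rule finite_subset)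
    qed (simp add: g_def)
    also have "(\<Sum>i | g i \<noteq> 0. g i * D i) = (\<Sum>i\<in>S. g i * D i)"
      using S g_supp by (intro sum.mono_neutral_left) auto
    finally have "0 \<le> (\<Sum>i\<in>S. g i * D i) + v * (\<Sum>i\<in>S. D i)"
      using D_nonneg \<open>v > 0\<close> by simp
    also have "\<dots> = (\<Sum>i\<in>S. f i * D i)"
      by (simp add: g_S sum_distrib_left left_diff_distrib flip: sum.distrib)
    finally show ?thesis by (simp add: S_def)
  qed (simp add: S_def)
qed

section \<open>Coefficients of products\<close>

lemma icoeff_support: "{z. icoeff p z \<noteq> 0} \<subseteq> {0..int (degree p)}"
proof (clarsimp simp: icoeff_def split: if_splits)
  fix z assume "coeff p (nat z) \<noteq> 0" "\<not> z < 0"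
  then show "z \<le> int (degree p)"
    using le_degree[of p "nat z"] by linarith
qed

lemma finite_icoeff_support: "finite {z. icoeff p z \<noteq> 0}"
  using icoeff_support by (rule finite_subset) simp

lemma icoeff_mult:
  "icoeff (p * q) z = (\<Sum>i | icoeff p i \<noteq> 0. icoeff p i * icoeff q (z - i))"
proof -
  have "icoeff (p * q) z = (\<Sum>i\<in>{0..int (degree p)}. icoeff p i * icoeff q (z - i))"
  proof (cases "z < 0")
    case True
    then show ?thesis by (auto simp: icoeff_def intro!: sum.neutral[symmetric])
  next
    case False
    have "icoeff (p * q) z = (\<Sum>i\<le>nat z. coeff p i * coeff q (nat z - i))"
      using False by (simp add: icoeff_def coeff_mult)
    also have "\<dots> = (\<Sum>i\<in>{0..z}. icoeff p i * icoeff q (z - i))"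
      using False
      by (intro sum.reindex_bij_witness[of _ nat int]) (auto simp: icoeff_def nat_diff_distrib)
    also have "\<dots> = (\<Sum>i\<in>{0..max z (int (degree p))}. icoeff p i * icoeff q (z - i))"
      by (intro sum.mono_neutral_left) (auto simp: icoeff_def)
    also have "\<dots> = (\<Sum>i\<in>{0..int (degree p)}. icoeff p i * icoeff q (z - i))"
      using icoeff_support[of p] by (intro sum.mono_neutral_right) auto
    finally show ?thesis .
  qed
  also have "\<dots> = (\<Sum>i | icoeff p i \<noteq> 0. icoeff p i * icoeff q (z - i))"
    using icoeff_support[of p] by (intro sum.mono_neutral_right) auto
  finally show ?thesis .
qed

lemma sum_shift_diff:
  fixes g :: "int \<Rightarrow> real"
  assumes "a \<le> b"
  shows "(\<Sum>i=a..b. g (k + 1 - i) - g (k - i)) = g (k + 1 - a) - g (k - b)"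
  using assms
proof (induction b rule: int_ge_induct)
  case (step i)
  have "{a..i + 1} = insert (i + 1) {a..i}" using step by auto
  then show ?case using step by (simp add: algebra_simps)
qed simp

text \<open>The increment of the product weights the increments of \<open>q\<close> by the peaked
  coefficients of \<open>p\<close>. By \<open>peaked_sum_nonneg\<close> only interval sums matter,
  and these telescope to a comparison of \<open>q\<close> at k - b and k + 1 - a; s stands for a +
  b.\<close>

lemma icoeff_mult_increasing:
  assumes p: "peaked c (icoeff p)" "\<And>z. icoeff p z \<ge> 0" and q: "peaked e (icoeff q)"
    and "\<And>s. c - 1 < of_int s \<Longrightarrow> of_int s < c + 1 \<Longrightarrow> of_int (2 * k + 1 - s) \<le> e"
  shows "icoeff (p * q) k \<le> icoeff (p * q) (k + 1)"
proof -
  have "0 \<le> (\<Sum>i | icoeff p i \<noteq> 0. icoeff p i * (icoeff q (k + 1 - i) - icoeff q (k - i)))"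
  proof (rule peaked_sum_nonneg[OF p finite_icoeff_support])
    fix a b :: int
    assume "a \<le> b" and "c - 1 < of_int (a + b)" "of_int (a + b) < c + 1"
    then have "of_int ((k - b) + (k + 1 - a)) \<le> e"
      using assms(4)[of "a + b"] by simp
    with \<open>a \<le> b\<close> show "0 \<le> (\<Sum>i=a..b. icoeff q (k + 1 - i) - icoeff q (k - i))"
      by (simp only: sum_shift_diff) (use peakedD1[OF q, of "k - b" "k + 1 - a"] in simp)
  qed
  then show ?thesis
    by (simp add: icoeff_mult right_diff_distrib sum_subtractf)
qed

lemma icoeff_mult_decreasing:
  assumes p: "peaked c (icoeff p)" "\<And>z. icoeff p z \<ge> 0" and q: "peaked e (icoeff q)"
    and "\<And>s. c - 1 < of_int s \<Longrightarrow> of_int s < c + 1 \<Longrightarrow> e \<le> of_int (2 * k + 1 - s)"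
  shows "icoeff (p * q) (k + 1) \<le> icoeff (p * q) k"
proof -
  have "0 \<le> (\<Sum>i | icoeff p i \<noteq> 0. icoeff p i * - (icoeff q (k + 1 - i) - icoeff q (k - i)))"
  proof (rule peaked_sum_nonneg[OF p finite_icoeff_support])
    fix a b :: int
    assume "a \<le> b" and "c - 1 < of_int (a + b)" "of_int (a + b) < c + 1"
    then have "e \<le> of_int ((k - b) + (k + 1 - a))"
      using assms(4)[of "a + b"] by simp
    with \<open>a \<le> b\<close> show "0 \<le> (\<Sum>i=a..b. - (icoeff q (k + 1 - i) - icoeff q (k - i)))"
      by (simp only: sum_shift_diff sum_negf) (use peakedD2[OF q, of "k - b" "k + 1 - a"] in simp)
  qed
  then show ?thesis
    by (simp add: icoeff_mult right_diff_distrib sum_subtractf)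
qed

lemma peaked_mult:
  assumes p: "peaked (of_int c) (icoeff p)" "\<And>z. icoeff p z \<ge> 0" and q: "peaked (of_int e) (icoeff q)"
  shows "peaked (of_int (c + e)) (icoeff (p * q))"
proof (rule peakedI)
  show "icoeff (p * q) (c + e - z) = icoeff (p * q) z" for z
    unfolding icoeff_mult
  proof (rule sum.reindex_bij_witness[of _ "\<lambda>i. c - i" "\<lambda>i. c - i"])
    fix i
    have "e - (z - (c - i)) = c + e - z - i" by simp
    then show "icoeff p (c - i) * icoeff q (z - (c - i)) = icoeff p i * icoeff q (c + e - z - i)"
      using peaked_reflect[OF p(1)] peaked_reflect[OF q] by metis
  qed (simp_all add: peaked_reflect[OF p(1)])
  show "icoeff (p * q) z \<le> icoeff (p * q) (z + 1)" if "2 * z + 1 \<le> c + e" for z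
  proof (rule icoeff_mult_increasing[OF p q])
    fix s assume "real_of_int c - 1 < of_int s" "of_int s < real_of_int c + 1"
    then have "s = c" by linarith
    then show "real_of_int (2 * z + 1 - s) \<le> of_int e"
      using that by simp
  qed
qed

section \<open>Unimodality of the two h-star candidates\<close>

lemma unimodal_veronese_mult:
  fixes n :: nat
  defines "m \<equiv> 2 * n + 1"
  shows "unimodal_with_middle_peak (2 * n) (coeff (veronese m (Suc n) * veronese m n))"
proof -
  define P where "P = veronese m (Suc n)"
  define Q where "Q = veronese m n"
  have "m > 0" by (simp add: m_def)
  define c where "c = real (Suc n) * (real m - 1) / real m"
  define e where "e = real n * (real m - 1) / real m"
  have P: "peaked c (icoeff P)" "\<And>z. icoeff P z \<ge> 0" and Q: "peaked e (icoeff Q)"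
    using peaked_veronese[OF \<open>m > 0\<close>] icoeff_veronese_nonneg[OF \<open>m > 0\<close>]
    by (simp_all only: P_def Q_def c_def e_def)
  \<comment> \<open>Here c = n + n/m and e = n - n/m. So s is n or n + 1, and 2 i + 1 - s is at most
    n - 1 for i < n and at least n for i \<ge> n: the rounding just fits.\<close>
  have c: "of_int (int n) \<le> c" "c < of_int (int n + 1)" and e: "real_of_int (int n - 1) \<le> e" "e \<le> of_int (int n)"
    by (simp_all add: c_def e_def m_def field_simps)
  have s: "s = int n \<or> s = int n + 1" if "c - 1 < of_int s" "of_int s < c + 1" for s
  proof -
    have "real_of_int (int n - 1) < of_int s" "real_of_int s < of_int (int n + 2)"
      using c that by simp_all
    then show ?thesis by linarith
  qed
  have icoeff: "coeff R i = icoeff R (int i)" for R i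
    by (simp add: icoeff_def)
  show ?thesis
    unfolding unimodal_with_middle_peak_def P_def[symmetric] Q_def[symmetric] icoeff
  proof (intro conjI allI impI)
    fix i assume "i < 2 * n div 2"
    then have "icoeff (P * Q) (int i) \<le> icoeff (P * Q) (int i + 1)"
    proof (intro icoeff_mult_increasing[OF P Q])
      fix s assume "c - 1 < of_int s" "of_int s < c + 1"
      from s[OF this] \<open>i < 2 * n div 2\<close> have "2 * int i + 1 - s \<le> int n - 1" by auto
      then show "real_of_int (2 * int i + 1 - s) \<le> e" using e by linarith
    qed
    then show "icoeff (P * Q) (int i) \<le> icoeff (P * Q) (int (i + 1))"
      by (simp add: add.commute)
  next
    fix i assume "2 * n div 2 \<le> i \<and> i < 2 * n"
    then have "icoeff (P * Q) (int i + 1) \<le> icoeff (P * Q) (int i)"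
    proof (intro icoeff_mult_decreasing[OF P Q])
      fix s assume "c - 1 < of_int s" "of_int s < c + 1"
      from s[OF this] \<open>2 * n div 2 \<le> i \<and> i < 2 * n\<close> have "2 * int i + 1 - s \<ge> int n" by auto
      then show "e \<le> real_of_int (2 * int i + 1 - s)" using e by linarith
    qed
    then show "icoeff (P * Q) (int (i + 1)) \<le> icoeff (P * Q) (int i)"
      by (simp add: add.commute)
  qed
qed

lemma unimodal_veronese_power2:
  assumes "n > 0"
  shows "unimodal_with_middle_peak (2 * n - 2)
    (coeff (poly_section 2 (gsum 2 ^ (2 * n - 1) * (veronese n n)\<^sup>2)))"
proof -
  have "real n * (real n - 1) / real n = real_of_int (int n - 1)"
    using assms by simp
  then have peaked: "peaked (of_int (int n - 1)) (icoeff (veronese n n))"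
    using peaked_veronese[OF assms, of n] by (simp only:)
  define F where "F = icoeff (gsum 2 ^ (2 * n - 1) * (veronese n n)\<^sup>2)"
  have "peaked (of_int ((int n - 1) + (int n - 1))) (icoeff ((veronese n n)\<^sup>2))"
    unfolding power2_eq_square
    by (rule peaked_mult[OF peaked icoeff_veronese_nonneg[OF assms] peaked])
  from peaked_gsum_power_mult[of 2, OF _ this, of "2 * n - 1"]
  \<comment> \<open>The square contributes 2 (n - 1) and the power of 1 + t contributes 2 n - 1. The
    indices 2 i and 2 (i + 1) sum to 4 i + 2, which passes 4 n - 3 between i = n - 2 and i = n -
    1.\<close>
  have F: "peaked (of_int (4 * int n - 3)) F"
    using assms by (simp add: F_def of_nat_diff algebra_simps)
  have coeff: "coeff (poly_section 2 (gsum 2 ^ (2 * n - 1) * (veronese n n)\<^sup>2)) i = F (2 * int i)" for i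
    by (simp add: coeff_poly_section F_def icoeff_def nat_mult_distrib mult.commute)
  show ?thesis
    unfolding unimodal_with_middle_peak_def coeff
  proof (intro conjI allI impI)
    fix i assume "i < (2 * n - 2) div 2"
    then show "F (2 * int i) \<le> F (2 * int (i + 1))"
      by (intro peakedD1[OF F]) auto
  next
    fix i assume "(2 * n - 2) div 2 \<le> i \<and> i < 2 * n - 2"
    then have "n \<le> i + 1" by arith
    then show "F (2 * int (i + 1)) \<le> F (2 * int i)"
      by (intro peakedD2[OF F]) auto
  qed
qed

section \<open>Counting\<close>

text \<open>Requiring zero off \<open>A\<close> makes each function on \<open>A\<close> count once
  although functions are total.\<close>

definition compositions :: "'a set \<Rightarrow> nat \<Rightarrow> ('a \<Rightarrow> nat) set" where
  "compositions A k = {f. (\<forall>x. x \<notin> A \<longrightarrow> f x = 0) \<and> sum f A = k}"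

lemma card_split_sum:
  assumes "finite A" "finite B" "A \<inter> B = {}"
  shows "card {f. (\<forall>x. x \<notin> A \<union> B \<longrightarrow> f x = 0) \<and> sum f A = i \<and> sum f B = j}
    = card (compositions A i) * card (compositions B j)"
proof -
  have "bij_betw (\<lambda>f. (\<lambda>x. if x \<in> A then f x else 0, \<lambda>x. if x \<in> B then f x else 0))
      {f. (\<forall>x. x \<notin> A \<union> B \<longrightarrow> f x = 0) \<and> sum f A = i \<and> sum f B = j}
      (compositions A i \<times> compositions B j)"
  proof (rule bij_betw_byWitness[where f' = "\<lambda>(g, h) x. g x + h x"])
    show "\<forall>a\<in>{f. (\<forall>x. x \<notin> A \<union> B \<longrightarrow> f x = 0) \<and> sum f A = i \<and> sum f B = j}.
      (case (\<lambda>x. if x \<in> A then a x else 0, \<lambda>x. if x \<in> B then a x else 0) of (g, h) \<Rightarrow> \<lambda>x. g x + h x) = a"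
      using assms(3) by (auto simp: fun_eq_iff)
    show "\<forall>a'\<in>compositions A i \<times> compositions B j.
      (\<lambda>x. if x \<in> A then (case a' of (g, h) \<Rightarrow> \<lambda>x. g x + h x) x else 0,
       \<lambda>x. if x \<in> B then (case a' of (g, h) \<Rightarrow> \<lambda>x. g x + h x) x else 0) = a'"
      using assms(3) by (auto simp: fun_eq_iff compositions_def)
    show "(\<lambda>f. (\<lambda>x. if x \<in> A then f x else 0, \<lambda>x. if x \<in> B then f x else 0)) `
      {f. (\<forall>x. x \<notin> A \<union> B \<longrightarrow> f x = 0) \<and> sum f A = i \<and> sum f B = j}
      \<subseteq> compositions A i \<times> compositions B j"
      by (auto simp: compositions_def)
    have "sum h A = 0" if "\<forall>x. x \<notin> B \<longrightarrow> h x = 0" for h :: "'a \<Rightarrow> nat"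
      using that assms(3) by (intro sum.neutral) auto
    moreover have "sum g B = 0" if "\<forall>x. x \<notin> A \<longrightarrow> g x = 0" for g :: "'a \<Rightarrow> nat"
      using that assms(3) by (intro sum.neutral) auto
    ultimately show "(\<lambda>(g, h) x. g x + h x) ` (compositions A i \<times> compositions B j) \<subseteq>
      {f. (\<forall>x. x \<notin> A \<union> B \<longrightarrow> f x = 0) \<and> sum f A = i \<and> sum f B = j}"
      by (auto simp: compositions_def sum.distrib)
  qed
  then show ?thesis
    by (simp add: bij_betw_same_card card_cartesian_product)
qed

text \<open>A new element takes each value i once and leaves k - i for the others, which is a
  convolution with \<open>geo\<close>.\<close>

lemma card_compositions:
  "finite A \<Longrightarrow> finite (compositions A k) \<and> real (card (compositions A k)) = fps_nth (geo ^ card A) k"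
proof (induction A arbitrary: k rule: finite_induct)
  case empty
  have "compositions ({} :: 'a set) k = (if k = 0 then {\<lambda>_. 0} else {})"
    by (auto simp: compositions_def)
  then show ?case by simp
next
  case (insert x A)
  define T where "T = (\<lambda>i. {f. (\<forall>y. y \<notin> {x} \<union> A \<longrightarrow> f y = 0) \<and> sum f {x} = i \<and> sum f A = k - i})"
  have eq: "compositions (insert x A) k = (\<Union>i\<in>{0..k}. T i)"
    using insert.hyps by (auto simp: compositions_def T_def)
  have "compositions {x} i = {(\<lambda>_. 0)(x := i)}" for i
    by (auto simp: compositions_def fun_eq_iff)
  then have card: "card (T i) = card (compositions A (k - i))" for i
    unfolding T_def using insert.hyps by (subst card_split_sum) auto
  have fin: "finite (T i)" for i
  proof -
    have "T i \<subseteq> (\<lambda>f. f(x := i)) ` compositions A (k - i)"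
    proof
      fix f assume f: "f \<in> T i"
      have "sum (f(x := 0)) A = sum f A"
        using insert.hyps by (intro sum.cong) auto
      then have "f(x := 0) \<in> compositions A (k - i)"
        using f by (auto simp: T_def compositions_def)
      moreover have "f = (f(x := 0))(x := i)"
        using f by (auto simp: T_def)
      ultimately show "f \<in> (\<lambda>f. f(x := i)) ` compositions A (k - i)" by blast
    qed
    then show ?thesis
      using insert.IH by (meson finite_imageI finite_subset)
  qed
  have "card (\<Union>i\<in>{0..k}. T i) = (\<Sum>i\<in>{0..k}. card (T i))"
    using fin by (intro card_UN_disjoint) (auto simp: T_def)
  then have "real (card (compositions (insert x A) k)) = (\<Sum>i\<in>{0..k}. fps_nth (geo ^ card A) (k - i))"
    using insert.IH by (simp add: eq card)
  also have "\<dots> = fps_nth (geo ^ card (insert x A)) k"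
    using insert.hyps by (simp add: fps_mult_nth geo_def)
  finally show ?case
    using fin by (simp add: eq)
qed

text \<open>
  Up to scaling, \<open>f\<close> lists the barycentric coordinates of a lattice point of a dilated polytope
  with respect to its vertices.
\<close>

definition divisible_compositions :: "'a::finite set \<Rightarrow> nat \<Rightarrow> nat \<Rightarrow> ('a \<Rightarrow> nat) set" where
  "divisible_compositions A m k =
     {f. m dvd sum f A \<and> m dvd sum f (- A) \<and> sum f UNIV = m * k}"

lemma sum_UNIV_split:
  fixes f :: "'a::finite \<Rightarrow> 'b::comm_monoid_add"
  shows "sum f UNIV = sum f A + sum f (- A)"
  using sum.union_disjoint[of A "- A" f] by simp

text \<open>If \<open>sum f A\<close> is i times m, then k - i times m is left for the complement,
  so the counts convolve.\<close>

lemma card_divisible_compositions: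
  assumes "m > 0"
  shows "finite (divisible_compositions A m k) \<and> real (card (divisible_compositions A m k)) =
    fps_nth (fps_section m (geo ^ card A) * fps_section m (geo ^ card (- A))) k"
proof -
  define T where "T = (\<lambda>i. {f. (\<forall>x. x \<notin> A \<union> - A \<longrightarrow> f x = 0) \<and> sum f A = i * m \<and> sum f (- A) = (k - i) * m})"
  have eq: "divisible_compositions A m k = (\<Union>i\<in>{0..k}. T i)"
  proof (intro equalityI subsetI)
    fix f assume "f \<in> divisible_compositions A m k"
    then obtain a b where "sum f A = m * a" "sum f (- A) = m * b" "sum f UNIV = m * k"
      by (auto simp: divisible_compositions_def elim!: dvdE)
    then have "m * (a + b) = m * k"
      by (simp add: sum_UNIV_split[of f A] distrib_left)
    then have "a + b = k" using assms by simp
    then have "f \<in> T a"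
      using \<open>sum f A = m * a\<close> \<open>sum f (- A) = m * b\<close> by (auto simp: T_def)
    then show "f \<in> (\<Union>i\<in>{0..k}. T i)"
      using \<open>a + b = k\<close> by auto
  next
    fix f assume "f \<in> (\<Union>i\<in>{0..k}. T i)"
    then obtain i where "i \<le> k" "sum f A = i * m" "sum f (- A) = (k - i) * m"
      by (auto simp: T_def)
    then show "f \<in> divisible_compositions A m k"
      by (simp add: divisible_compositions_def sum_UNIV_split[of f A] flip: distrib_right)
  qed
  have "finite (compositions (UNIV :: 'a set) (m * k))"
    using card_compositions[of "UNIV :: 'a set"] by simp
  then have fin: "finite (divisible_compositions A m k)"
    by (rule rev_finite_subset) (auto simp: divisible_compositions_def compositions_def)
  have "card (\<Union>i\<in>{0..k}. T i) = (\<Sum>i\<in>{0..k}. card (T i))"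
  proof (rule card_UN_disjoint)
    show "\<forall>i\<in>{0..k}. finite (T i)"
      using fin unfolding eq by (meson UN_upper finite_subset)
  qed (use assms in \<open>auto simp: T_def\<close>)
  also have "\<dots> = (\<Sum>i\<in>{0..k}. card (compositions A (i * m)) * card (compositions (- A) ((k - i) * m)))"
    unfolding T_def by (subst card_split_sum) auto
  finally show ?thesis
    using fin by (simp add: eq fps_mult_nth card_compositions fps_section_def)
qed

section \<open>Recognising the h-star polynomial\<close>

lemma hstar_poly_eqI:
  assumes "nat (aff_dim P) = D" "degree h \<le> D"
    and "ehrhart_series P = fps_of_poly h * geo ^ Suc D"
  shows "hstar_poly P = h"
  unfolding hstar_poly_def assms(1) divide_one_minus_X_power
proof (rule the_equality)
  show "degree h \<le> D \<and> ehrhart_series P = fps_of_poly h * geo ^ (D + 1)"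
    using assms by simp
  fix h' assume "degree h' \<le> D \<and> ehrhart_series P = fps_of_poly h' * geo ^ (D + 1)"
  then have "fps_of_poly h' * geo ^ Suc D = fps_of_poly h * geo ^ Suc D"
    using assms by (simp only: Suc_eq_plus1)
  \<comment> \<open>A nonzero power of \<open>geo\<close> cancels, so the numerator is unique, as
    \<open>THE\<close> demands.\<close>
  moreover have "geo ^ Suc D \<noteq> 0"
    using one_minus_X_geo_power[of "Suc D"] by auto
  ultimately have "fps_of_poly h' = fps_of_poly h"
    by (metis mult_right_cancel)
  then show "h' = h" by (simp only: fps_of_poly_eq_iff)
qed

lemma veronese_product_gf:
  assumes "m > 0"
  shows "fps_section m (geo ^ p) * fps_section m (geo ^ q)
    = fps_of_poly (veronese m p * veronese m q) * geo ^ (p + q)"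
  by (simp only: veronese_gf[OF assms] fps_of_poly_mult power_add mult_ac)

text \<open>The factor 1 - t lowers the exponent of \<open>geo\<close> from 2 n to 2 n - 1. Taking
  even coefficients then multiplies the numerator by the same power of 1 + t before it is
  sectioned.\<close>

lemma even_section_gf:
  assumes "n > 0"
  shows "fps_section 2 ((1 - fps_X) * (fps_section n (geo ^ n) * fps_section n (geo ^ n)))
    = fps_of_poly (poly_section 2 (gsum 2 ^ (2 * n - 1) * (veronese n n)\<^sup>2)) * geo ^ (2 * n - 1)"
proof (rule fps_eq_times_geo)
  define k where "k = 2 * n - 1"
  have "n + n = Suc k" using assms by (simp add: k_def)
  define V where "V = fps_of_poly ((veronese n n)\<^sup>2)"
  have *: "(1 - fps_X) * (fps_section n (geo ^ n) * fps_section n (geo ^ n)) = V * geo ^ k"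
    unfolding veronese_product_gf[OF assms] \<open>n + n = Suc k\<close> geo_power_conv_Suc[of k]
    by (simp only: V_def power2_eq_square mult_ac)
  have "(1 - fps_X) ^ k * fps_section 2 (V * geo ^ k) = fps_section 2 ((1 - fps_X ^ 2) ^ k * (V * geo ^ k))"
    by (rule fps_section_shift_power) simp
  also have "(1 - fps_X ^ 2) ^ k * (V * geo ^ k) = fps_of_poly (gsum 2) ^ k * V * ((1 - fps_X) ^ k * geo ^ k)"
    by (simp only: fps_of_gsum[symmetric] power_mult_distrib mult_ac)
  also have "\<dots> = fps_of_poly (gsum 2 ^ k * (veronese n n)\<^sup>2)"
    by (simp only: one_minus_X_geo_power fps_of_poly_power fps_of_poly_mult V_def mult_1_right)
  also have "fps_section 2 \<dots> = fps_of_poly (poly_section 2 (gsum 2 ^ k * (veronese n n)\<^sup>2))"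
    by (rule fps_section_of_poly) simp
  finally show "(1 - fps_X) ^ (2 * n - 1) *
      fps_section 2 ((1 - fps_X) * (fps_section n (geo ^ n) * fps_section n (geo ^ n)))
    = fps_of_poly (poly_section 2 (gsum 2 ^ (2 * n - 1) * (veronese n n)\<^sup>2))"
    by (simp only: * k_def[symmetric])
qed

lemma degree_even_hstar:
  assumes "n > 0"
  shows "degree (poly_section 2 (gsum 2 ^ (2 * n - 1) * (veronese n n)\<^sup>2)) \<le> 2 * n - 2"
proof -
  have "degree (gsum 2 ^ (2 * n - 1)) \<le> 1 * (2 * n - 1)"
    using degree_gsum[of 2] by (intro order.trans[OF degree_power_le] mult_le_mono1) simp
  moreover have "degree ((veronese n n)\<^sup>2) \<le> (n - 1) * 2"
    using degree_veronese[OF assms assms] by (intro order.trans[OF degree_power_le] mult_le_mono1) simp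
  ultimately have "degree (gsum 2 ^ (2 * n - 1) * (veronese n n)\<^sup>2) \<le> (2 * n - 1) + (n - 1) * 2"
    by (intro order.trans[OF degree_mult_le]) simp
  then have "degree (gsum 2 ^ (2 * n - 1) * (veronese n n)\<^sup>2) div 2 \<le> 2 * n - 2"
    using assms by linarith
  then show ?thesis
    using degree_poly_section[of 2] by (meson order.trans zero_less_numeral)
qed

section \<open>The Laplacian matrix\<close>

unbundle vec_syntax

text \<open>The position of \<open>b\<close> in the sorted list is the number of smaller elements,
  which is easier to count.\<close>

lemma boundary_entry_eq:
  assumes "finite \<sigma>"
  shows "boundary_entry \<tau> \<sigma> = (\<Sum>b\<in>\<sigma>. if \<tau> = \<sigma> - {b} then (-1) ^ card {x \<in> \<sigma>. x < b} else 0)"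
proof -
  define l where "l = sorted_list_of_set \<sigma>"
  have l: "distinct l" "set l = \<sigma>" "length l = card \<sigma>" "sorted_wrt (<) l"
    using assms by (simp_all add: l_def)
  have "card {x \<in> \<sigma>. x < l ! k} = k" if "k < card \<sigma>" for k
  proof -
    have "{x \<in> \<sigma>. x < l ! k} = (!) l ` {..<k}"
    proof (intro equalityI subsetI)
      fix x assume x: "x \<in> {x \<in> \<sigma>. x < l ! k}"
      then have "x \<in> set l" by (simp add: l(2))
      then obtain i where i: "i < card \<sigma>" "x = l ! i"
        using l(3) by (auto simp: in_set_conv_nth)
      have "\<not> k \<le> i"
        using sorted_wrt_nth_less[OF l(4), of k i] l(3) i x by (cases "k = i") auto
      then show "x \<in> (!) l ` {..<k}" using i by auto
    next
      fix x assume "x \<in> (!) l ` {..<k}"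
      then obtain i where "i < k" "x = l ! i" by auto
      moreover from this have "x \<in> set l" using that l(3) by simp
      ultimately show "x \<in> {x \<in> \<sigma>. x < l ! k}"
        using that l(2,3) sorted_wrt_nth_less[OF l(4), of i k] by auto
    qed
    moreover have "inj_on ((!) l) {..<k}"
      using that l by (auto intro!: inj_on_nth)
    ultimately show ?thesis by (simp add: card_image)
  qed
  moreover have "bij_betw ((!) l) {..<card \<sigma>} \<sigma>"
    using l by (intro bij_betw_nth) auto
  ultimately show ?thesis
    unfolding boundary_entry_def l_def[symmetric]
    by (subst sum.reindex_bij_betw[symmetric, of "(!) l" "{..<card \<sigma>}" \<sigma>]) (auto intro!: sum.cong)
qed

lemma boundary_entry_remove:
  assumes "finite \<sigma>" "b \<in> \<sigma>"
  shows "boundary_entry (\<sigma> - {b}) \<sigma> = (-1) ^ card {x \<in> \<sigma>. x < b}"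
proof -
  have "\<sigma> - {b} = \<sigma> - {b'} \<longleftrightarrow> b' = b" if "b' \<in> \<sigma>" for b'
    using assms that by auto
  then have "boundary_entry (\<sigma> - {b}) \<sigma> = (\<Sum>b'\<in>\<sigma>. if b' = b then (-1) ^ card {x \<in> \<sigma>. x < b'} else 0)"
    unfolding boundary_entry_eq[OF assms(1)] by (intro sum.cong) auto
  then show ?thesis using assms by simp
qed

text \<open>A face with d + 2 vertices would be the removed full simplex; so the first sum of the
  Laplacian is empty.\<close>

lemma faces_simplex_boundary_top: "faces (simplex_boundary d) (int d + 1) = {}"
proof -
  have "\<sigma> \<notin> faces (simplex_boundary d) (int d + 1)" for \<sigma>
  proof
    assume "\<sigma> \<in> faces (simplex_boundary d) (int d + 1)"
    then have "\<sigma> \<subseteq> {1..d+2}" "\<sigma> \<noteq> {1..d+2}" "int (card \<sigma>) = int (d + 2)"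
      by (auto simp: faces_def simplex_boundary_def)
    moreover from this have "\<sigma> = {1..d+2}"
      by (intro card_subset_eq) auto
    ultimately show False by simp
  qed
  then show ?thesis by blast
qed

text \<open>Two distinct facets share exactly one ridge, the one missing both \<open>a\<close> and
  \<open>a'\<close>; on the diagonal each of the d + 1 ridges of a facet contributes 1.\<close>

lemma laplacian_facets:
  assumes "d > 0" "a \<in> {1..d+2}" "a' \<in> {1..d+2}"
  shows "laplacian (simplex_boundary d) (int d) ({1..d+2} - {a}) ({1..d+2} - {a'})
    = (if a = a' then int d + 2 else 0) - (-1) ^ (a + a')"
proof -
  define \<sigma> where "\<sigma> = (\<lambda>a. {1..d+2} - {a})"
  have \<sigma>: "finite (\<sigma> a)" "\<sigma> a \<subseteq> {1..d+2}" for a by (auto simp: \<sigma>_def)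
  have card: "card (\<sigma> a) = d + 1" if "a \<in> {1..d+2}" for a
    using that by (simp add: \<sigma>_def)
  have "finite (faces (simplex_boundary d) (int d - 1))"
    by (rule finite_subset[of _ "Pow {1..d+2}"]) (auto simp: faces_def simplex_boundary_def)
  \<comment> \<open>For \<open>d > 0\<close> the ridges have nonnegative dimension d - 1, so
    \<open>faces\<close> contains them.\<close>
  moreover have "(\<lambda>b. \<sigma> a - {b}) ` \<sigma> a \<subseteq> faces (simplex_boundary d) (int d - 1)"
    using assms card[OF assms(2)] \<sigma>[of a] by (auto simp: faces_def simplex_boundary_def)
  moreover have "boundary_entry \<tau> (\<sigma> a) = 0" if "\<tau> \<notin> (\<lambda>b. \<sigma> a - {b}) ` \<sigma> a" for \<tau>
    using that unfolding boundary_entry_eq[OF \<sigma>(1)] by (intro sum.neutral) auto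
  ultimately have "laplacian (simplex_boundary d) (int d) (\<sigma> a) (\<sigma> a')
    = (\<Sum>\<tau>\<in>(\<lambda>b. \<sigma> a - {b}) ` \<sigma> a. boundary_entry \<tau> (\<sigma> a) * boundary_entry \<tau> (\<sigma> a'))"
    unfolding laplacian_def faces_simplex_boundary_top
    by (simp, intro sum.mono_neutral_right) auto
  also have "\<dots> = (\<Sum>b\<in>\<sigma> a. boundary_entry (\<sigma> a - {b}) (\<sigma> a) * boundary_entry (\<sigma> a - {b}) (\<sigma> a'))"
    by (rule sum.reindex_cong) (auto simp: inj_on_def)
  also have "\<dots> = (if a = a' then int d + 2 else 0) - (-1) ^ (a + a')"
  proof (cases "a = a'")
    case True
    have "(\<Sum>b\<in>\<sigma> a. boundary_entry (\<sigma> a - {b}) (\<sigma> a) * boundary_entry (\<sigma> a - {b}) (\<sigma> a')) = (\<Sum>b\<in>\<sigma> a. 1)"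
      using True by (intro sum.cong) (simp_all add: boundary_entry_remove[OF \<sigma>(1)] flip: power_mult_distrib)
    then show ?thesis
      using True card[OF assms(2)] by (simp flip: mult_2)
  next
    case False
    have "boundary_entry (\<sigma> a - {b}) (\<sigma> a') = 0" if "b \<in> \<sigma> a" "b \<noteq> a'" for b
    proof -
      have "a' \<in> \<sigma> a - {b}" using False that(2) assms(3) by (simp add: \<sigma>_def)
      moreover have "a' \<notin> \<sigma> a' - {b'}" for b' by (simp add: \<sigma>_def)
      ultimately have "\<sigma> a - {b} \<noteq> \<sigma> a' - {b'}" for b' by metis
      then show ?thesis by (simp add: boundary_entry_eq[OF \<sigma>(1)])
    qed
    then have "(\<Sum>b\<in>\<sigma> a. boundary_entry (\<sigma> a - {b}) (\<sigma> a) * boundary_entry (\<sigma> a - {b}) (\<sigma> a'))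
      = (\<Sum>b\<in>{a'}. boundary_entry (\<sigma> a - {b}) (\<sigma> a) * boundary_entry (\<sigma> a - {b}) (\<sigma> a'))"
      using False assms(3) \<sigma>(1) by (intro sum.mono_neutral_right) (simp_all add: \<sigma>_def)
    also have "\<dots> = (-1) ^ card {x \<in> \<sigma> a. x < a'} * (-1) ^ card {x \<in> \<sigma> a'. x < a}"
    proof -
      have mem: "a' \<in> \<sigma> a" "a \<in> \<sigma> a'"
        using False assms by (simp_all add: \<sigma>_def)
      have "\<sigma> a - {a'} = \<sigma> a' - {a}"
        by (auto simp: \<sigma>_def)
      then have "boundary_entry (\<sigma> a - {a'}) (\<sigma> a') = (-1) ^ card {x \<in> \<sigma> a'. x < a}"
        by (simp only: boundary_entry_remove[OF \<sigma>(1) mem(2)])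
      then show ?thesis
        by (simp add: boundary_entry_remove[OF \<sigma>(1) mem(1)])
    qed
    also have "\<dots> = - ((-1) ^ (a + a'))"
    proof -
      have pos: "(-1) ^ card {x \<in> \<sigma> a. x < a'} * (-1) ^ card {x \<in> \<sigma> a'. x < a} = - ((-1 :: int) ^ (a + a'))"
        if "a < a'" "a \<in> {1..d+2}" "a' \<in> {1..d+2}" for a a'
      proof -
        \<comment> \<open>Below a' the first facet lacks the vertex a, below a the second lacks
          none: the ranks are a' - 2 and a - 1.\<close>
        have "{x \<in> \<sigma> a. x < a'} = {1..<a'} - {a}" "{x \<in> \<sigma> a'. x < a} = {1..<a}"
          using that by (auto simp: \<sigma>_def)
        moreover have "card ({1..<a'} - {a}) = a' - 2"
          using that by simp
        ultimately have "(-1) ^ card {x \<in> \<sigma> a. x < a'} * (-1) ^ card {x \<in> \<sigma> a'. x < a}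
            = (-1 :: int) ^ (a' - 2 + (a - 1))"
          by (simp add: power_add)
        moreover have "a + a' = Suc (a' - 2 + (a - 1)) + 2"
          using that by simp
        ultimately show ?thesis
          by (simp only: power_Suc power_add) simp
      qed
      show ?thesis
        using pos[of a a'] pos[of a' a] False assms
        by (cases "a < a'") (simp_all add: mult.commute add.commute)
    qed
    finally show ?thesis using False by simp
  qed
  finally show ?thesis by (simp add: \<sigma>_def)
qed

lemma laplacian_matrix_nth:
  assumes "bij_betw ix UNIV {1..d+2}" "d > 0"
  shows "laplacian_matrix ix d $ r $ c = (if r = c then real d + 2 else 0) - (-1) ^ ix r * (-1) ^ ix c"
proof -
  have ix: "ix r \<in> {1..d+2}" for r
    using assms(1) by (auto simp: bij_betw_def)
  have facet: "d + 3 - ix r \<in> {1..d+2}" for r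
    using ix[of r] unfolding atLeastAtMost_iff by arith
  have "(d + 3 - ix r = d + 3 - ix c) = (r = c)"
    using assms(1) ix[of r] ix[of c] by (auto simp: bij_betw_def inj_on_def)
  moreover have "(-1 :: real) ^ (d + 3 - ix r + (d + 3 - ix c)) = (-1) ^ ix r * (-1) ^ ix c"
  proof -
    \<comment> \<open>Facet number i omits the vertex d + 3 - i; the offset occurs twice and does
      not affect the parity.\<close>
    have "even (d + 3 - ix r + (d + 3 - ix c)) = even (ix r + ix c)"
      using ix[of r] ix[of c] by (simp add: even_diff_nat)
    then show ?thesis
      by (simp add: minus_one_power_iff flip: power_add)
  qed
  ultimately show ?thesis
    unfolding laplacian_matrix_def simplex_facet_def
    by (simp only: vec_lambda_beta laplacian_facets[OF assms(2) facet facet]) simp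
qed

text \<open>The complex consists of isolated points and the empty face is excluded, so both sums of
  the Laplacian are empty.\<close>

lemma laplacian_matrix_0: "laplacian_matrix ix 0 = 0"
proof -
  have "faces (simplex_boundary 0) (int 0 + 1) = {}" "faces (simplex_boundary 0) (int 0 - 1) = {}"
    by (simp only: faces_simplex_boundary_top) (simp add: faces_def)
  then show ?thesis
    by (simp only: laplacian_matrix_def laplacian_def sum.empty) (simp add: vec_eq_iff)
qed

section \<open>Lattice points and dimension of the polytope\<close>

text \<open>
  Conjugation with the diagonal matrix of the signs \<open>s\<close> turns the matrix with columns \<open>vertex c\<close>
  into \<open>N I - J\<close>, where \<open>N\<close> is its size and \<open>J\<close> the all-ones matrix.
\<close>

locale sign_vector =
  fixes s :: "'n::finite \<Rightarrow> real"
  assumes sign: "s r = 1 \<or> s r = -1"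
begin

definition vertex :: "'n \<Rightarrow> real ^ 'n" where
  "vertex c = (\<chi> r. (if r = c then real CARD('n) else 0) - s r * s c)"

definition mean :: "('n \<Rightarrow> real) \<Rightarrow> real" where
  "mean w = (\<Sum>j\<in>UNIV. s j * w j) / real CARD('n)"

text \<open>The orthogonal projection along \<open>s\<close>, as the inner product of
  \<open>s\<close> with itself is \<open>CARD('n)\<close>; its kernel is spanned by
  \<open>s\<close>.\<close>

definition proj :: "('n \<Rightarrow> real) \<Rightarrow> real ^ 'n" where
  "proj w = (\<chi> r. w r - s r * mean w)"

definition pos :: "'n set" where
  "pos = {r. s r = 1}"

lemma s_square: "s r * s r = 1"
  using sign[of r] by auto

lemma s_pos: "r \<in> pos \<Longrightarrow> s r = 1" and s_neg: "r \<in> - pos \<Longrightarrow> s r = -1"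
  using sign[of r] by (auto simp: pos_def)

lemma sum_signed: "(\<Sum>j\<in>UNIV. s j * w j) = sum w pos - sum w (- pos)"
  by (subst sum_UNIV_split[of _ pos]) (simp add: s_pos s_neg sum_negf)

lemma sum_signs: "(\<Sum>j\<in>UNIV. s j) = real (card pos) - real (card (- pos))"
  using sum_signed[of "\<lambda>_. 1"] by simp

text \<open>The matrix with columns \<open>vertex c\<close> is N I - s s^T, which is N times the
  projection.\<close>

lemma sum_vertex: "(\<Sum>c\<in>UNIV. u c *\<^sub>R vertex c) = proj (\<lambda>r. real CARD('n) * u r)"
proof -
  have "(\<Sum>c\<in>UNIV. u c * ((if r = c then real CARD('n) else 0) - s r * s c))
      = real CARD('n) * u r - s r * (\<Sum>c\<in>UNIV. s c * u c)" for r
    by (simp add: right_diff_distrib sum_subtractf sum_distrib_left if_distrib[of "\<lambda>x. _ * x"] mult_ac cong: if_cong)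
  moreover have "mean (\<lambda>r. real CARD('n) * u r) = (\<Sum>c\<in>UNIV. s c * u c)"
  proof -
    have "(\<Sum>c\<in>UNIV. s c * (real CARD('n) * u c)) = real CARD('n) * (\<Sum>c\<in>UNIV. s c * u c)"
      by (simp add: sum_distrib_left mult.left_commute)
    then show ?thesis by (simp add: mean_def)
  qed
  ultimately show ?thesis
    by (simp add: vec_eq_iff vertex_def proj_def)
qed

text \<open>Weights indexed by coordinates rather than by points allow for coinciding
  vertices.\<close>

lemma convex_hull_vertex:
  "convex hull (range vertex) = {\<Sum>c\<in>UNIV. u c *\<^sub>R vertex c | u. (\<forall>c. 0 \<le> u c) \<and> sum u UNIV = 1}"
    (is "_ = ?X")
proof
  show "convex hull (range vertex) \<subseteq> ?X"
  proof (rule hull_minimal)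
    show "range vertex \<subseteq> ?X"
    proof clarify
      fix c
      show "\<exists>u. vertex c = (\<Sum>c\<in>UNIV. u c *\<^sub>R vertex c) \<and> (\<forall>c. 0 \<le> u c) \<and> sum u UNIV = 1"
        by (rule exI[of _ "\<lambda>x. if x = c then 1 else 0"]) (simp add: if_distrib[of "\<lambda>x. x *\<^sub>R _"] cong: if_cong)
    qed
    show "convex ?X"
    proof (rule convexI, clarify)
      fix a b :: real and u w :: "'n \<Rightarrow> real"
      assume "0 \<le> a" "0 \<le> b" "a + b = 1" "\<forall>c. 0 \<le> u c" "sum u UNIV = 1" "\<forall>c. 0 \<le> w c" "sum w UNIV = 1"
      then show "\<exists>v. a *\<^sub>R (\<Sum>c\<in>UNIV. u c *\<^sub>R vertex c) + b *\<^sub>R (\<Sum>c\<in>UNIV. w c *\<^sub>R vertex c) = (\<Sum>c\<in>UNIV. v c *\<^sub>R vertex c)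
          \<and> (\<forall>c. 0 \<le> v c) \<and> sum v UNIV = 1"
        by (intro exI[of _ "\<lambda>c. a * u c + b * w c"])
          (simp add: scaleR_sum_right scaleR_add_left sum.distrib flip: sum_distrib_left)
    qed
  qed
  show "?X \<subseteq> convex hull (range vertex)"
    by (clarify, rule convex_sum) (auto intro: hull_inc)
qed

lemma proj_scale: "proj (\<lambda>r. k * w r) = k *\<^sub>R proj w"
  by (simp add: vec_eq_iff proj_def mean_def sum_distrib_left[symmetric] mult.left_commute right_diff_distrib)

lemma mem_dilated_iff:
  "x \<in> (\<lambda>x. real n *\<^sub>R x) ` (convex hull (range vertex)) \<longleftrightarrow>
    (\<exists>w. (\<forall>r. 0 \<le> w r) \<and> sum w UNIV = real n * real CARD('n) \<and> x = proj w)"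
proof
  assume "x \<in> (\<lambda>x. real n *\<^sub>R x) ` (convex hull (range vertex))"
  then obtain u where u: "\<forall>c. 0 \<le> u c" "sum u UNIV = 1" "x = real n *\<^sub>R proj (\<lambda>r. real CARD('n) * u r)"
    by (auto simp: convex_hull_vertex sum_vertex)
  then show "\<exists>w. (\<forall>r. 0 \<le> w r) \<and> sum w UNIV = real n * real CARD('n) \<and> x = proj w"
    by (intro exI[of _ "\<lambda>r. real n * (real CARD('n) * u r)"])
      (simp only: proj_scale sum_distrib_left[symmetric], simp)
next
  assume "\<exists>w. (\<forall>r. 0 \<le> w r) \<and> sum w UNIV = real n * real CARD('n) \<and> x = proj w"
  then obtain w where w: "\<forall>r. 0 \<le> w r" "sum w UNIV = real n * real CARD('n)" "x = proj w"
    by blast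
  show "x \<in> (\<lambda>x. real n *\<^sub>R x) ` (convex hull (range vertex))"
  proof (cases "n = 0")
    case True
    then have "w = (\<lambda>_. 0)"
      using w sum_nonneg_eq_0_iff[of UNIV w] by auto
    then have "x = 0"
      using w(3) by (simp add: proj_def mean_def vec_eq_iff)
    moreover obtain y where "y \<in> convex hull (range vertex)"
      by (meson hull_inc rangeI)
    ultimately show ?thesis using True by (intro image_eqI[of _ _ y]) auto
  next
    case False
    define u where "u = (\<lambda>r. w r / (real n * real CARD('n)))"
    have "x = real n *\<^sub>R (\<Sum>c\<in>UNIV. u c *\<^sub>R vertex c)"
      using False by (simp add: sum_vertex w(3) u_def flip: proj_scale)
    moreover have "sum u UNIV = 1" "\<forall>c. 0 \<le> u c"
      using w False by (simp_all add: u_def flip: sum_divide_distrib)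
    ultimately show ?thesis
      unfolding convex_hull_vertex by blast
  qed
qed

lemma proj_eqD:
  assumes "proj w = proj w'"
  obtains k where "\<And>r. w r - w' r = k * s r"
proof
  fix r
  have "w r - s r * mean w = w' r - s r * mean w'"
    using assms by (simp add: proj_def vec_eq_iff)
  then show "w r - w' r = (mean w - mean w') * s r"
    by (simp add: algebra_simps)
qed

lemma mean_shift: "mean (\<lambda>r. w r + s r * t) = mean w + t"
  by (simp add: mean_def distrib_left sum.distrib add_divide_distrib s_square flip: mult.assoc)

lemma proj_shift: "proj (\<lambda>r. w r + s r * t) = proj w"
  by (simp add: proj_def vec_eq_iff mean_shift distrib_left)

lemma sum_shift: "card pos = card (- pos) \<Longrightarrow> (\<Sum>r\<in>UNIV. w r + s r * t) = sum w UNIV"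
  by (simp add: sum.distrib sum_signs flip: sum_distrib_right)

lemma mean_of_nat:
  "mean (\<lambda>r. real (f r)) = (real (sum f pos) - real (sum f (- pos))) / real CARD('n)"
  by (simp add: mean_def sum_signed)

lemma proj_Ints: "mean w \<in> \<int> \<Longrightarrow> (\<And>r. w r \<in> \<int>) \<Longrightarrow> proj w $ r \<in> \<int>"
  using sign[of r] by (auto simp: proj_def)

section \<open>Lattice points as nonnegative integer vectors\<close>

lemma lattice_point_of_nat:
  assumes "mean (\<lambda>r. real (f r)) \<in> \<int>" "sum f UNIV = n * CARD('n)"
  shows "proj (\<lambda>r. real (f r)) \<in> lattice_points ((\<lambda>x. real n *\<^sub>R x) ` (convex hull (range vertex)))"
  unfolding lattice_points_def mem_dilated_iff mem_Collect_eq
proof (intro conjI allI exI[of _ "\<lambda>r. real (f r)"])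
  show "(\<Sum>r\<in>UNIV. real (f r)) = real n * real CARD('n)"
    using assms(2) by (metis of_nat_mult of_nat_sum)
qed (use assms in \<open>auto intro: proj_Ints\<close>)

text \<open>An integral mean makes w integral, because w is its projection plus the mean times
  \<open>s\<close>.\<close>

lemma lattice_point_cases:
  assumes "\<And>r. 0 \<le> w r" "mean w \<in> \<int>" "\<And>r. proj w $ r \<in> \<int>"
  obtains f k where "w = (\<lambda>r. real (f r))" "int (sum f pos) - int (sum f (- pos)) = int CARD('n) * k"
proof -
  have "w r \<in> \<int>" for r
  proof -
    have "w r = proj w $ r + s r * mean w" by (simp add: proj_def)
    then show ?thesis using assms(2) assms(3)[of r] sign[of r] by auto
  qed
  then have "\<exists>n. w r = real n" for r
    using assms(1)[of r] by (metis Ints_cases of_int_0_le_iff of_int_of_nat_eq zero_le_imp_eq_int)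
  then obtain f where f: "w = (\<lambda>r. real (f r))"
    by metis
  moreover obtain k where "mean w = of_int k"
    using assms(2) by (auto elim: Ints_cases)
  then have "real (sum f pos) - real (sum f (- pos)) = real CARD('n) * of_int k"
    unfolding f mean_of_nat by (simp add: field_simps)
  then have "real_of_int (int (sum f pos) - int (sum f (- pos))) = real_of_int (int CARD('n) * k)"
    by simp
  then have "int (sum f pos) - int (sum f (- pos)) = int CARD('n) * k"
    by (simp only: of_int_eq_iff)
  ultimately show ?thesis using that by blast
qed

lemma sum_eq_of_proj:
  assumes "proj (\<lambda>r. real (f r)) = proj (\<lambda>r. real (g r))"
  obtains k where "\<And>r. real (f r) - real (g r) = k * s r"
    "real (sum f UNIV) - real (sum g UNIV) = k * (\<Sum>r\<in>UNIV. s r)"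
proof -
  from assms obtain k where k: "\<And>r. real (f r) - real (g r) = k * s r"
    using proj_eqD by blast
  have "real (sum f UNIV) - real (sum g UNIV) = (\<Sum>r\<in>UNIV. real (f r) - real (g r))"
    by (simp add: sum_subtractf)
  also have "\<dots> = k * (\<Sum>r\<in>UNIV. s r)"
    by (simp add: k sum_distrib_left)
  finally show ?thesis
    using that[OF k] by blast
qed

text \<open>The signs sum to -1, so fixing the sum of the weights excludes adding nonzero multiples
  of \<open>s\<close>: each point has only one vector f.\<close>

lemma lattice_points_odd:
  assumes "card (- pos) = Suc (card pos)"
  shows "bij_betw (\<lambda>f. proj (\<lambda>r. real (f r))) (divisible_compositions pos CARD('n) n)
    (lattice_points ((\<lambda>x. real n *\<^sub>R x) ` (convex hull (range vertex))))"
proof (rule bij_betw_imageI)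
  have signs: "(\<Sum>r\<in>UNIV. s r) = -1"
    using assms by (simp add: sum_signs)
  have N: "CARD('n) = 2 * card pos + 1"
    using assms sum_UNIV_split[of "\<lambda>_. 1 :: nat" pos] by simp
  show "inj_on (\<lambda>f. proj (\<lambda>r. real (f r))) (divisible_compositions pos CARD('n) n)"
  proof (rule inj_onI)
    fix f g
    assume "f \<in> divisible_compositions pos CARD('n) n" "g \<in> divisible_compositions pos CARD('n) n"
      and eq: "proj (\<lambda>r. real (f r)) = proj (\<lambda>r. real (g r))"
    then have "sum f UNIV = sum g UNIV" by (simp add: divisible_compositions_def)
    moreover obtain k where k: "\<And>r. real (f r) - real (g r) = k * s r"
      "real (sum f UNIV) - real (sum g UNIV) = k * (\<Sum>r\<in>UNIV. s r)"
      using sum_eq_of_proj[OF eq] by blast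
    ultimately have "k = 0" by (simp add: signs)
    then show "f = g" using k(1) by (simp add: fun_eq_iff)
  qed
  show "(\<lambda>f. proj (\<lambda>r. real (f r))) ` divisible_compositions pos CARD('n) n =
    lattice_points ((\<lambda>x. real n *\<^sub>R x) ` (convex hull (range vertex)))"
  proof (intro equalityI subsetI)
    fix x assume "x \<in> (\<lambda>f. proj (\<lambda>r. real (f r))) ` divisible_compositions pos CARD('n) n"
    then obtain f where f: "x = proj (\<lambda>r. real (f r))" "f \<in> divisible_compositions pos CARD('n) n"
      by blast
    then obtain a b where "sum f pos = CARD('n) * a" "sum f (- pos) = CARD('n) * b"
      by (auto simp: divisible_compositions_def elim!: dvdE)
    then have "mean (\<lambda>r. real (f r)) = real a - real b"
      unfolding mean_of_nat by (simp add: field_simps)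
    then have "mean (\<lambda>r. real (f r)) \<in> \<int>" by simp
    then show "x \<in> lattice_points ((\<lambda>x. real n *\<^sub>R x) ` (convex hull (range vertex)))"
      using f by (simp add: lattice_point_of_nat divisible_compositions_def mult.commute)
  next
    fix x assume "x \<in> lattice_points ((\<lambda>x. real n *\<^sub>R x) ` (convex hull (range vertex)))"
    then obtain w where w: "\<And>r. 0 \<le> w r" "sum w UNIV = real n * real CARD('n)" "x = proj w"
      and ints: "\<And>r. x $ r \<in> \<int>"
      unfolding lattice_points_def mem_dilated_iff by blast
    \<comment> \<open>Summing the coordinates isolates the mean, since the signs sum to -1.\<close>
    have "(\<Sum>r\<in>UNIV. x $ r) = sum w UNIV - (\<Sum>r\<in>UNIV. s r) * mean w"
      by (simp add: w(3) proj_def sum_subtractf sum_distrib_right)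
    then have "mean w = (\<Sum>r\<in>UNIV. x $ r) - real n * real CARD('n)"
      by (simp add: signs w(2))
    then have "mean w \<in> \<int>" using ints by auto
    then obtain f k where f: "w = (\<lambda>r. real (f r))"
      and k: "int (sum f pos) - int (sum f (- pos)) = int CARD('n) * k"
      using lattice_point_cases[of w] w(1,3) ints by metis
    have sum: "sum f UNIV = CARD('n) * n"
      using w(2) unfolding f by (metis mult.commute of_nat_eq_iff of_nat_mult of_nat_sum)
    then have "int (sum f pos) + int (sum f (- pos)) = int CARD('n) * int n"
      by (metis of_nat_add of_nat_mult sum_UNIV_split)
    with k have "2 * int (sum f pos) = int CARD('n) * (k + int n)"
      "2 * int (sum f (- pos)) = int CARD('n) * (int n - k)"
      by (simp_all add: algebra_simps)
    then have "int CARD('n) dvd 2 * int (sum f pos)" "int CARD('n) dvd 2 * int (sum f (- pos))"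
      by simp_all
    moreover have "coprime (int CARD('n)) 2"
      unfolding N by simp
    ultimately have "int CARD('n) dvd int (sum f pos)" "int CARD('n) dvd int (sum f (- pos))"
      by (simp_all only: coprime_dvd_mult_right_iff)
    then have "f \<in> divisible_compositions pos CARD('n) n"
      using sum by (simp only: int_dvd_int_iff divisible_compositions_def mem_Collect_eq)
    then show "x \<in> (\<lambda>f. proj (\<lambda>r. real (f r))) ` divisible_compositions pos CARD('n) n"
      using w(3) f by blast
  qed
qed

text \<open>
  Here the fibres of \<open>proj\<close> on the vectors with a given sum are lines parallel to \<open>s\<close>. The
  condition \<open>\<exists>r\<in>- pos. f r = 0\<close> selects the last nonnegative vector on each of them in the direction of \<open>s\<close>.
\<close>

lemma lattice_points_even:
  assumes "card (- pos) = m" "card pos = m" "m > 0"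
  shows "bij_betw (\<lambda>f. proj (\<lambda>r. real (f r))) {f \<in> divisible_compositions pos m (2 * n). \<exists>r\<in>- pos. f r = 0}
    (lattice_points ((\<lambda>x. real n *\<^sub>R x) ` (convex hull (range vertex))))"
    (is "bij_betw ?proj ?T _")
proof (rule bij_betw_imageI)
  have N: "CARD('n) = 2 * m"
    using assms sum_UNIV_split[of "\<lambda>_. 1 :: nat" pos] by simp
  show "inj_on ?proj ?T"
  proof (rule inj_onI)
    fix f g assume f: "f \<in> ?T" and g: "g \<in> ?T" and eq: "?proj f = ?proj g"
    obtain k where k: "\<And>r. real (f r) - real (g r) = k * s r"
      using proj_eqD[OF eq] by blast
    from f obtain r where r: "r \<in> - pos" "f r = 0" by auto
    from g obtain r' where r': "r' \<in> - pos" "g r' = 0" by auto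
    \<comment> \<open>The zero of f at r gives k = g r \<ge> 0, the zero of g at r' gives k = - f r'
      \<le> 0.\<close>
    have "k = 0"
      using k[of r] k[of r'] s_neg[OF r(1)] s_neg[OF r'(1)] r(2) r'(2) by simp
    then show "f = g" using k by (simp add: fun_eq_iff)
  qed
  show "?proj ` ?T = lattice_points ((\<lambda>x. real n *\<^sub>R x) ` (convex hull (range vertex)))"
  proof (intro equalityI subsetI)
    fix x assume "x \<in> ?proj ` ?T"
    then obtain f where f: "x = ?proj f" "f \<in> divisible_compositions pos m (2 * n)"
      by blast
    then obtain a b where ab: "sum f pos = m * a" "sum f (- pos) = m * b"
      by (auto simp: divisible_compositions_def elim!: dvdE)
    with f have "m * (a + b) = m * (2 * n)"
      by (simp add: divisible_compositions_def sum_UNIV_split[of f pos] distrib_left)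
    \<comment> \<open>Because a + b = 2 n, the mean (a - b) / 2 is the integer n - b.\<close>
    then have "real a + real b = 2 * real n"
      using assms(3) by (simp flip: of_nat_add)
    moreover have "mean (\<lambda>r. real (f r)) = (real a - real b) / 2"
      unfolding mean_of_nat N using ab assms(3) by (simp add: field_simps)
    ultimately have "mean (\<lambda>r. real (f r)) = real n - real b" by simp
    then have "mean (\<lambda>r. real (f r)) \<in> \<int>" by simp
    then show "x \<in> lattice_points ((\<lambda>x. real n *\<^sub>R x) ` (convex hull (range vertex)))"
      using f by (simp add: lattice_point_of_nat divisible_compositions_def N mult_ac)
  next
    fix x assume "x \<in> lattice_points ((\<lambda>x. real n *\<^sub>R x) ` (convex hull (range vertex)))"
    then obtain w where w: "\<And>r. 0 \<le> w r" "sum w UNIV = real n * real CARD('n)" "x = proj w"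
      and ints: "\<And>r. x $ r \<in> \<int>"
      unfolding lattice_points_def mem_dilated_iff by blast
    \<comment> \<open>Moving by the smallest weight of negative sign keeps all weights nonnegative
      and makes one of them 0.\<close>
    define t where "t = Min (w ` (- pos))"
    have "- pos \<noteq> {}" using assms by force
    then have "t \<in> w ` (- pos)"
      unfolding t_def by (intro Min_in) auto
    then obtain r0 where r0: "r0 \<in> - pos" "w r0 = t"
      by blast
    have t_le: "t \<le> w r" if "r \<in> - pos" for r
      using that by (simp add: t_def)
    have "0 \<le> t" using w(1)[of r0] r0 by simp
    define v where "v = (\<lambda>r. w r + s r * t)"
    have v_nonneg: "0 \<le> v r" for r
      using t_le[of r] w(1)[of r] \<open>0 \<le> t\<close> s_pos[of r] s_neg[of r] by (cases "r \<in> pos") (simp_all add: v_def)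
    have v: "x = proj v" "sum v UNIV = real n * real CARD('n)"
      using w assms by (simp_all add: v_def proj_shift sum_shift)
    have "v r0 = 0" using r0 s_neg[of r0] by (simp add: v_def)
    \<comment> \<open>Where a weight of negative sign vanishes, the coordinate of x is the mean
      itself, which is thus an integer.\<close>
    then have "mean v = x $ r0"
      using s_neg[OF r0(1)] by (simp add: v(1) proj_def)
    then have "mean v \<in> \<int>" using ints by simp
    then obtain f k where f: "v = (\<lambda>r. real (f r))"
      and k: "int (sum f pos) - int (sum f (- pos)) = int CARD('n) * k"
      using lattice_point_cases[of v] v_nonneg v(1) ints by metis
    have sum: "sum f UNIV = CARD('n) * n"
      using v(2) unfolding f by (metis mult.commute of_nat_eq_iff of_nat_mult of_nat_sum)
    then have "int (sum f pos) + int (sum f (- pos)) = int CARD('n) * int n"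
      by (metis of_nat_add of_nat_mult sum_UNIV_split)
    with k have "int (sum f pos) = int m * (k + int n)" "int (sum f (- pos)) = int m * (int n - k)"
      by (simp_all add: N algebra_simps)
    then have "int m dvd int (sum f pos)" "int m dvd int (sum f (- pos))"
      by (simp_all only: dvd_triv_left)
    moreover have "sum f UNIV = m * (2 * n)"
      using sum by (simp add: N)
    ultimately have "f \<in> divisible_compositions pos m (2 * n)"
      by (simp only: int_dvd_int_iff divisible_compositions_def mem_Collect_eq)
    moreover have "f r0 = 0" using \<open>v r0 = 0\<close> f by simp
    ultimately show "x \<in> ?proj ` ?T"
      using v(1) f r0(1) by blast
  qed
qed

text \<open>The complement consists of the f that are positive on all m elements of
  \<open>- pos\<close>; subtracting 1 there lowers k by one, whence the factor 1 - t.\<close>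

lemma card_divisible_compositions_vanishing:
  assumes "card (- pos) = m" "m > 0"
  shows "real (card {f \<in> divisible_compositions pos m k. \<exists>r\<in>- pos. f r = 0}) =
    fps_nth ((1 - fps_X) * (fps_section m (geo ^ card pos) * fps_section m (geo ^ m))) k"
proof -
  define U where "U = {f \<in> divisible_compositions pos m k. \<forall>r\<in>- pos. f r \<noteq> 0}"
  define F where "F = fps_section m (geo ^ card pos) * fps_section m (geo ^ m)"
  have card: "finite (divisible_compositions pos m k)"
    "real (card (divisible_compositions pos m k)) = fps_nth F k" for k
    using card_divisible_compositions[OF assms(2), of pos k] assms(1) by (simp_all add: F_def)
  have sum: "(\<Sum>r\<in>A. if r \<in> - pos then f r + 1 else f r) = sum f A + card (A \<inter> - pos)"
    for f :: "'n \<Rightarrow> nat" and A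
  proof -
    have "(\<Sum>r\<in>A. if r \<in> - pos then f r + 1 else f r) = (\<Sum>r\<in>A. f r + (if r \<in> - pos then 1 else 0))"
      by (intro sum.cong) auto
    moreover have "card (A \<inter> - pos) = (\<Sum>r\<in>A. if r \<in> - pos then 1 else 0)"
      by (simp only: card_eq_sum sum.inter_restrict finite)
    ultimately show ?thesis by (simp only: sum.distrib)
  qed
  have "real (card U) = fps_nth (fps_X * F) k"
  proof (cases k)
    case 0
    have "U = {}"
    proof -
      have "f r = 0" if "f \<in> divisible_compositions pos m k" for f r
        using that 0 by (simp add: divisible_compositions_def)
      moreover have "- pos \<noteq> {}" using assms by force
      ultimately show ?thesis by (auto simp: U_def)
    qed
    then show ?thesis using 0 by simp
  next
    case (Suc j)
    have "bij_betw (\<lambda>f r. if r \<in> - pos then f r + 1 else f r) (divisible_compositions pos m j) U"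
    proof (rule bij_betw_byWitness[where f' = "\<lambda>f r. if r \<in> - pos then f r - 1 else f r"])
      show "\<forall>f\<in>divisible_compositions pos m j.
          (\<lambda>r. if r \<in> - pos then (if r \<in> - pos then f r + 1 else f r) - 1 else (if r \<in> - pos then f r + 1 else f r)) = f"
        by (auto simp: fun_eq_iff)
      show "\<forall>f\<in>U. (\<lambda>r. if r \<in> - pos then (if r \<in> - pos then f r - 1 else f r) + 1 else (if r \<in> - pos then f r - 1 else f r)) = f"
        by (auto simp: fun_eq_iff U_def)
      show "(\<lambda>f r. if r \<in> - pos then f r + 1 else f r) ` divisible_compositions pos m j \<subseteq> U"
      proof clarify
        fix f assume f: "f \<in> divisible_compositions pos m j"
        define g where "g = (\<lambda>r. if r \<in> - pos then f r + 1 else f r)"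
        have "sum g A = sum f A + card (A \<inter> - pos)" for A
          unfolding g_def by (rule sum)
        then have "sum g pos = sum f pos" "sum g (- pos) = sum f (- pos) + m" "sum g UNIV = sum f UNIV + m"
          using assms(1) by simp_all
        moreover have "\<forall>r\<in>- pos. g r \<noteq> 0" by (simp add: g_def)
        ultimately show "g \<in> U"
          using f Suc by (simp add: U_def divisible_compositions_def)
      qed
      show "(\<lambda>f r. if r \<in> - pos then f r - 1 else f r) ` U \<subseteq> divisible_compositions pos m j"
      proof clarify
        fix f assume f: "f \<in> U"
        define g where "g = (\<lambda>r. if r \<in> - pos then f r - 1 else f r)"
        have f_eq: "f = (\<lambda>r. if r \<in> - pos then g r + 1 else g r)"
          using f by (auto simp: fun_eq_iff g_def U_def)
        have "sum f A = sum g A + card (A \<inter> - pos)" for A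
          using sum[of g A] unfolding f_eq[symmetric] .
        then have "sum f pos = sum g pos" "sum f (- pos) = sum g (- pos) + m" "sum f UNIV = sum g UNIV + m"
          using assms(1) by simp_all
        moreover have "m dvd sum f pos" "m dvd sum f (- pos)" "sum f UNIV = m * Suc j"
          using f Suc by (simp_all add: U_def divisible_compositions_def)
        ultimately have "m dvd sum g pos" "m dvd sum g (- pos)" "sum g UNIV = m * j"
          by simp_all
        then show "g \<in> divisible_compositions pos m j"
          by (simp only: divisible_compositions_def mem_Collect_eq)
      qed
    qed
    then have "card U = card (divisible_compositions pos m j)"
      by (simp add: bij_betw_same_card)
    then show ?thesis using Suc card by simp
  qed
  moreover have "card {f \<in> divisible_compositions pos m k. \<exists>r\<in>- pos. f r = 0} + card U
      = card (divisible_compositions pos m k)"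
  proof -
    have "{f \<in> divisible_compositions pos m k. \<exists>r\<in>- pos. f r = 0} = divisible_compositions pos m k - U"
      by (auto simp: U_def Ball_def)
    moreover have "U \<subseteq> divisible_compositions pos m k"
      by (auto simp: U_def)
    ultimately show ?thesis
      using card(1)[of k] by (simp add: card_Diff_subset finite_subset card_mono)
  qed
  ultimately show ?thesis
    using card(2)[of k] by (simp add: left_diff_distrib F_def[symmetric])
qed

lemma ehrhart_series_odd:
  assumes "card pos = n" "card (- pos) = Suc n"
  shows "ehrhart_series (convex hull (range vertex)) =
    fps_of_poly (veronese (2 * n + 1) (Suc n) * veronese (2 * n + 1) n) * geo ^ (2 * n + 1)"
proof -
  have N: "CARD('n) = 2 * n + 1"
    using assms sum_UNIV_split[of "\<lambda>_. 1 :: nat" pos] by simp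
  have "ehrhart_series (convex hull (range vertex)) =
      fps_section (2 * n + 1) (geo ^ n) * fps_section (2 * n + 1) (geo ^ Suc n)"
  proof (rule fps_ext)
    fix k
    have "card (lattice_points ((\<lambda>x. real k *\<^sub>R x) ` (convex hull (range vertex))))
      = card (divisible_compositions pos (2 * n + 1) k)"
      using bij_betw_same_card[OF lattice_points_odd, of k] assms by (simp add: N)
    then show "fps_nth (ehrhart_series (convex hull (range vertex))) k =
      fps_nth (fps_section (2 * n + 1) (geo ^ n) * fps_section (2 * n + 1) (geo ^ Suc n)) k"
      using card_divisible_compositions[of "2 * n + 1" pos k] assms
      by (simp only: ehrhart_series_def fps_nth_Abs_fps)
  qed
  also have "\<dots> = fps_section (2 * n + 1) (geo ^ Suc n) * fps_section (2 * n + 1) (geo ^ n)"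
    by (rule mult.commute)
  also have "\<dots> = fps_of_poly (veronese (2 * n + 1) (Suc n) * veronese (2 * n + 1) n) * geo ^ (Suc n + n)"
    by (rule veronese_product_gf) simp
  also have "Suc n + n = 2 * n + 1" by simp
  finally show ?thesis .
qed

text \<open>As m is half of \<open>CARD('n)\<close>, the k-th dilate belongs to the divisible
  compositions with index 2 k, hence the even coefficients.\<close>

lemma ehrhart_series_even:
  assumes "card pos = m" "card (- pos) = m" "m > 0"
  shows "ehrhart_series (convex hull (range vertex)) =
    fps_of_poly (poly_section 2 (gsum 2 ^ (2 * m - 1) * (veronese m m)\<^sup>2)) * geo ^ (2 * m - 1)"
  unfolding even_section_gf[OF assms(3), symmetric]
proof (rule fps_ext)
  fix k
  have "card (lattice_points ((\<lambda>x. real k *\<^sub>R x) ` (convex hull (range vertex))))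
    = card {f \<in> divisible_compositions pos m (2 * k). \<exists>r\<in>- pos. f r = 0}"
    using bij_betw_same_card[OF lattice_points_even[OF assms(2,1,3)], of k] by simp
  then show "fps_nth (ehrhart_series (convex hull (range vertex))) k =
    fps_nth (fps_section 2 ((1 - fps_X) * (fps_section m (geo ^ m) * fps_section m (geo ^ m)))) k"
    using card_divisible_compositions_vanishing[OF assms(2,3), of "2 * k"] assms(1)
    by (simp only: ehrhart_series_def fps_section_def fps_nth_Abs_fps mult.commute[of k 2])
qed

section \<open>Affine dimension\<close>

lemma proj_eq_0D:
  assumes "proj w = 0"
  obtains k where "\<And>r. w r = k * s r"
proof -
  have "proj (\<lambda>_. 0) = 0"
    by (simp add: proj_def mean_def vec_eq_iff)
  with assms have "proj w = proj (\<lambda>_. 0)"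
    by (simp only:)
  then show ?thesis using proj_eqD[of w "\<lambda>_. 0"] that by auto
qed

text \<open>The vertex matrix has the same kernel as \<open>proj\<close>, the line spanned by
  \<open>s\<close>.\<close>

lemma vertex_relation:
  assumes "(\<Sum>c\<in>UNIV. u c *\<^sub>R vertex c) = 0"
  obtains k where "\<And>r. u r = k * s r"
proof -
  obtain k where "\<And>r. real CARD('n) * u r = k * s r"
    using assms unfolding sum_vertex using proj_eq_0D by blast
  then have "u r = k / real CARD('n) * s r" for r
    by (simp add: field_simps)
  then show ?thesis using that by blast
qed

text \<open>Equal vertices give a relation supported on two coordinates, but a nonzero multiple of
  \<open>s\<close> vanishes nowhere; a third coordinate gives the contradiction.\<close>

lemma inj_vertex:
  assumes "CARD('n) > 2"
  shows "inj vertex"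
proof (rule injI, rule ccontr)
  fix c c' assume eq: "vertex c = vertex c'" and "c \<noteq> c'"
  have delta: "(\<Sum>r\<in>UNIV. (if r = x then 1 else 0) *\<^sub>R vertex r) = vertex x" for x
    by (simp add: if_distrib[of "\<lambda>x. x *\<^sub>R _"] cong: if_cong)
  have *: "(\<Sum>r\<in>UNIV. ((if r = c then 1 else 0) - (if r = c' then 1 else 0)) *\<^sub>R vertex r) = 0"
    using eq by (simp only: scaleR_diff_left sum_subtractf delta) simp
  obtain k where k: "\<And>r. (if r = c then 1 else 0) - (if r = c' then 1 else 0) = k * s r"
    using vertex_relation[OF *] by blast
  have "\<exists>r. r \<notin> {c, c'}"
  proof (rule ccontr)
    assume "\<nexists>r. r \<notin> {c, c'}"
    then have "UNIV = {c, c'}" by blast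
    then have "CARD('n) = card {c, c'}" by (rule arg_cong)
    also have "\<dots> \<le> 2" by (simp add: card_insert_if)
    finally show False using assms by simp
  qed
  then obtain r where "r \<notin> {c, c'}" by blast
  then have "k = 0" using k[of r] sign[of r] by auto
  then show False using k[of c] \<open>c \<noteq> c'\<close> by simp
qed

text \<open>An affine relation, extended by zero, is a multiple of \<open>s\<close> that vanishes
  off \<open>B\<close> and has sum 0; the second assumption makes it trivial.\<close>

lemma affine_independent_vertex:
  assumes "CARD('n) > 2"
    and "\<And>k. (\<And>r. r \<notin> B \<Longrightarrow> k * s r = 0) \<Longrightarrow> k * (\<Sum>r\<in>UNIV. s r) = 0 \<Longrightarrow> k = 0"
  shows "\<not> affine_dependent (vertex ` B)"
proof
  have inj: "inj_on vertex B"
    using inj_vertex[OF assms(1)] by (rule inj_on_subset) simp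
  assume "affine_dependent (vertex ` B)"
  then obtain U v where U: "sum U (vertex ` B) = 0" "v \<in> vertex ` B" "U v \<noteq> 0"
    "(\<Sum>v\<in>vertex ` B. U v *\<^sub>R v) = 0"
    by (auto simp: affine_dependent_explicit_finite)
  define u where "u = (\<lambda>r. if r \<in> B then U (vertex r) else 0)"
  have "(\<Sum>r\<in>UNIV. u r *\<^sub>R vertex r) = (\<Sum>r\<in>B. U (vertex r) *\<^sub>R vertex r)"
    by (intro sum.mono_neutral_cong_right) (auto simp: u_def)
  also have "\<dots> = 0"
    using U(4) by (simp add: sum.reindex[OF inj])
  finally obtain k where k: "\<And>r. u r = k * s r"
    using vertex_relation by blast
  have "k * (\<Sum>r\<in>UNIV. s r) = sum u UNIV"
    by (simp add: k sum_distrib_left)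
  also have "\<dots> = (\<Sum>r\<in>B. U (vertex r))"
    by (intro sum.mono_neutral_cong_right) (auto simp: u_def)
  also have "\<dots> = 0"
    using U(1) by (simp add: sum.reindex[OF inj])
  finally have "k * (\<Sum>r\<in>UNIV. s r) = 0" .
  moreover have "k * s r = 0" if "r \<notin> B" for r
    using k[of r] that by (simp add: u_def)
  ultimately have "k = 0"
    using assms(2) by blast
  obtain r where "r \<in> B" "v = vertex r"
    using U(2) by blast
  then show False
    using U(3) k[of r] \<open>k = 0\<close> by (simp add: u_def)
qed

lemma aff_dim_odd:
  assumes "CARD('n) > 2" "(\<Sum>r\<in>UNIV. s r) \<noteq> 0"
  shows "aff_dim (convex hull (range vertex)) = int CARD('n) - 1"
proof -
  have "\<not> affine_dependent (range vertex)"
    using assms by (intro affine_independent_vertex) auto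
  then show ?thesis
    using inj_vertex[OF assms(1)]
    by (simp add: affine_independent_iff_card aff_dim_convex_hull card_image)
qed

text \<open>Now \<open>s\<close> itself is an affine relation between the vertices; dropping one
  vertex leaves an independent family, since \<open>s\<close> has no zero entry.\<close>

lemma aff_dim_even:
  assumes "CARD('n) > 2" "(\<Sum>r\<in>UNIV. s r) = 0"
  shows "aff_dim (convex hull (range vertex)) = int CARD('n) - 2"
proof -
  note inj = inj_vertex[OF assms(1)]
  obtain r0 :: 'n where True by blast
  have "\<not> affine_dependent (vertex ` (UNIV - {r0}))"
  proof (rule affine_independent_vertex[OF assms(1)])
    show "k = 0" if "\<And>r. r \<notin> UNIV - {r0} \<Longrightarrow> k * s r = 0" for k
      using that[of r0] sign[of r0] by auto
  qed
  moreover have "card (vertex ` (UNIV - {r0})) = CARD('n) - 1"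
    using inj by (subst card_image) (auto intro: inj_on_subset)
  ultimately have "aff_dim (vertex ` (UNIV - {r0})) = int CARD('n) - 2"
    using assms(1) by (simp add: affine_independent_iff_card of_nat_diff)
  moreover have "aff_dim (vertex ` (UNIV - {r0})) \<le> aff_dim (range vertex)"
    by (intro aff_dim_subset) auto
  moreover have "aff_dim (range vertex) \<le> int CARD('n) - 2"
  proof -
    have "(\<Sum>r\<in>UNIV. s r *\<^sub>R vertex r) = 0"
    proof -
      have "(\<Sum>r\<in>UNIV. s r * (real CARD('n) * s r)) = (\<Sum>r\<in>UNIV. real CARD('n) * (s r * s r))"
        by (intro sum.cong) (simp_all only: mult_ac)
      also have "\<dots> = real CARD('n) * real CARD('n)"
        by (simp add: s_square)
      finally have "mean (\<lambda>r. real CARD('n) * s r) = real CARD('n)"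
        by (simp add: mean_def)
      then show ?thesis
        by (simp add: sum_vertex vec_eq_iff proj_def)
    qed
    moreover have "s (inv vertex (vertex r0)) \<noteq> 0"
      using sign[of r0] inj by auto
    ultimately have "affine_dependent (range vertex)"
      using assms(2) inj unfolding affine_dependent_explicit_finite[OF finite_imageI[OF finite]]
      by (intro exI[of _ "\<lambda>v. s (inv vertex v)"]) (auto simp: sum.reindex)
    then have "aff_dim (range vertex) \<noteq> int (card (range vertex)) - 1"
      using affine_independent_iff_card[of "range vertex"] by simp
    moreover have "aff_dim (range vertex) \<le> int (card (range vertex)) - 1"
      by (rule aff_dim_le_card) simp
    moreover have "card (range vertex) = CARD('n)"
      using inj by (rule card_image)
    ultimately show ?thesis by simp
  qed
  ultimately show ?thesis
    by (simp add: aff_dim_convex_hull)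
qed

end

section \<open>The theorem for all dimensions\<close>

lemma card_parity:
  assumes "bij_betw ix UNIV {1..d+2}"
  shows "card {r. even (ix r)} = (d + 2) div 2" "card {r. odd (ix r)} = (d + 3) div 2"
proof -
  have card: "card {r. Q (ix r)} = card {i \<in> {1..d+2}. Q i}" for Q
  proof (rule bij_betw_same_card)
    show "bij_betw ix {r. Q (ix r)} {i \<in> {1..d+2}. Q i}"
      unfolding bij_betw_imp_surj_on[OF assms, symmetric]
      using bij_betw_imp_inj_on[OF assms] by (auto simp: bij_betw_def intro: inj_on_subset)
  qed
  have "{i \<in> {1..d+2}. even i} = (\<lambda>k. 2 * k) ` {1..(d + 2) div 2}"
    by (auto elim!: evenE)
  then show "card {r. even (ix r)} = (d + 2) div 2"
    by (simp only: card[of "\<lambda>i. even i"]) (simp add: card_image inj_on_def)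
  have "{i \<in> {1..d+2}. odd i} = (\<lambda>k. 2 * k + 1) ` {..<(d + 3) div 2}"
    by (auto elim!: oddE)
  then show "card {r. odd (ix r)} = (d + 3) div 2"
    by (simp only: card[of "\<lambda>i. odd i"]) (simp add: card_image inj_on_def)
qed

theorem theoremB:
  fixes d :: nat and ix :: "'n::finite \<Rightarrow> nat" and P :: "(real ^ 'n) set"
  assumes "bij_betw ix UNIV {1..d+2}"
    and "P = laplacian_polytope ix d"
  shows "(odd d \<longrightarrow> real_rooted (hstar_poly P)) \<and>
         aff_dim P = (if even d then int d else int d + 1) \<and>
         unimodal_with_middle_peak (nat (aff_dim P)) (coeff (hstar_poly P))"
proof (cases "d = 0")
  case True
  \<comment> \<open>For d = 0 the polytope is the origin, with h-star polynomial 1.\<close>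
  have "columns (laplacian_matrix ix d) = {0}"
    by (auto simp: True laplacian_matrix_0 columns_def column_def vec_eq_iff)
  then have P: "P = {0}"
    by (simp add: assms(2) laplacian_polytope_def)
  have "lattice_points {0 :: real ^ 'n} = {0}"
    by (auto simp: lattice_points_def)
  then have "ehrhart_series P = fps_of_poly 1 * geo ^ Suc 0"
    by (simp add: P ehrhart_series_def geo_def)
  then have "hstar_poly P = 1"
    by (intro hstar_poly_eqI[where D = 0]) (simp_all add: P)
  then show ?thesis
    by (simp add: True P unimodal_with_middle_peak_def)
next
  case False
  \<comment> \<open>The sign of a coordinate is the parity of its facet number, which turns the
    Laplacian into N I - s s^T.\<close>
  define s :: "'n \<Rightarrow> real" where "s = (\<lambda>r. (-1) ^ ix r)"
  have s_eq: "s r = (if even (ix r) then 1 else -1)" for r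
    by (simp add: s_def minus_one_power_iff)
  interpret sign_vector s
    by unfold_locales (simp add: s_eq)
  have N: "CARD('n) = d + 2"
    using bij_betw_same_card[OF assms(1)] by simp
  have "laplacian_matrix ix d $ r $ c = (if r = c then real CARD('n) else 0) - s r * s c" for r c
    using laplacian_matrix_nth[OF assms(1)] False by (simp add: s_def N)
  then have "column c (laplacian_matrix ix d) = vertex c" for c
    by (simp add: vec_eq_iff column_def vertex_def)
  then have P: "P = convex hull (range vertex)"
    by (simp add: assms(2) laplacian_polytope_def columns_def full_SetCompr_eq)
  have "pos = {r. even (ix r)}" "- pos = {r. odd (ix r)}"
    by (auto simp: pos_def s_eq split: if_splits)
  then have card: "card pos = (d + 2) div 2" "card (- pos) = (d + 3) div 2"
    using card_parity[OF assms(1)] by simp_all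
  have "CARD('n) > 2" using False by (simp add: N)
  show ?thesis
  proof (cases "even d")
    case True
    then obtain m where m: "d = 2 * m" by blast
    have dim: "aff_dim P = int d"
      using aff_dim_even[OF \<open>CARD('n) > 2\<close>] card by (simp add: P N sum_signs m)
    \<comment> \<open>There are \<open>Suc m\<close> signs of each kind.\<close>
    define h where "h = poly_section 2 (gsum 2 ^ (2 * Suc m - 1) * (veronese (Suc m) (Suc m))\<^sup>2)"
    have "hstar_poly P = h"
    proof (rule hstar_poly_eqI)
      show "nat (aff_dim P) = d" by (simp add: dim)
      show "degree h \<le> d"
        using degree_even_hstar[of "Suc m"] by (simp add: h_def m)
      have "ehrhart_series P = fps_of_poly h * geo ^ (2 * Suc m - 1)"
        unfolding P h_def by (rule ehrhart_series_even) (simp_all add: card m)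
      then show "ehrhart_series P = fps_of_poly h * geo ^ Suc d"
        by (simp add: m)
    qed
    moreover have "unimodal_with_middle_peak d (coeff h)"
      using unimodal_veronese_power2[of "Suc m"] by (simp add: h_def m)
    ultimately show ?thesis
      using True by (simp add: dim)
  next
    case False
    then obtain k where k: "d = 2 * k + 1" by (elim oddE)
    \<comment> \<open>The number of positive signs, and half of the dimension d + 1.\<close>
    define n where "n = Suc k"
    have n: "d + 1 = 2 * n" by (simp add: n_def k)
    have cards: "card pos = n" "card (- pos) = Suc n"
      using card by (simp_all add: n_def k)
    have dim: "aff_dim P = int d + 1"
      using aff_dim_odd[OF \<open>CARD('n) > 2\<close>] by (simp add: P N sum_signs cards)
    define m where "m = 2 * n + 1"
    define h where "h = veronese m (Suc n) * veronese m n"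
    have "m > 0" "n > 0" by (simp_all add: m_def n_def)
    have "hstar_poly P = h"
    proof (rule hstar_poly_eqI)
      show "nat (aff_dim P) = 2 * n" using n by (simp add: dim)
      show "degree h \<le> 2 * n"
        using degree_veronese[OF \<open>m > 0\<close>, of "Suc n"] degree_veronese[OF \<open>m > 0\<close> \<open>n > 0\<close>]
        unfolding h_def by (intro order.trans[OF degree_mult_le]) simp
      show "ehrhart_series P = fps_of_poly h * geo ^ Suc (2 * n)"
        using ehrhart_series_odd[OF cards] by (simp add: P h_def m_def)
    qed
    \<comment> \<open>Both exponents n and n + 1 respect the bound m = 2 n + 1.\<close>
    moreover have "real_rooted h"
      unfolding h_def using \<open>n > 0\<close>
      by (intro real_rooted_mult simple_negative_roots_imp_real_rooted
          simple_negative_roots_veronese[THEN conjunct2]) (simp_all add: m_def)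
    moreover have "unimodal_with_middle_peak (2 * n) (coeff h)"
      unfolding h_def m_def by (rule unimodal_veronese_mult)
    moreover have "nat (aff_dim P) = 2 * n" using n by (simp add: dim)
    ultimately show ?thesis
      using False by (simp add: dim)
  qed
qed

end
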